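(* An $(\alpha,\beta)$-metric $F=\alpha\,\phi(\beta/\alpha)$ on a conic subbundle $\mathcal A\subset TM$ is of Berwald type if and only if there exists a smooth tensor field $T^j{}_{ik}(x)=T^j{}_{ki}(x)$ on $M$ such that $$y^j\mathring\nabla_ib_j=T^j{}_{ik}y^k\left[b_j+\frac{\epsilon}{\alpha}\left(\frac{\phi}{\phi'}-\frac{\beta}{\alpha}\right)y_j\right]$$ at all points of $\mathcal A$ where $\phi'\neq0$, and $T^j{}_{ik}y^ky_j=0$ at all points of $\mathcal A$ where $\phi'=0$. In that case the affine connection of $F$ is given by $$\Gamma^j_{ik}=\mathring\Gamma^j_{ik}+T^j{}_{ik},$$ where $\mathring\Gamma^j_{ik}$ are the Levi-Civita Christoffel symbols of $a_{ij}$.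
   Context: $M$ is a smooth manifold; coordinates $x^i$ induce coordinates $(x^i,y^i)$ on $TM$; $\partial_i=\partial/\partial x^i$, $\bar\partial_i=\partial/\partial y^i$. A conic subbundle $\mathcal A\subset TM$ is an open subset projecting onto $M$ and closed under $(x,y)\mapsto(x,\lambda y)$, $\lambda>0$. A Finsler metric on $\mathcal A$ is a smooth $F:\mathcal A\to\mathbb R$ with $F(x,\lambda y)=\lambda F(x,y)$ for $\lambda>0$ and $g_{ij}=\tfrac12\bar\partial_i\bar\partial_jF^2$ nondegenerate; put $L=F^2$. Its canonical nonlinear connection is $N^j_i=\tfrac14\bar\partial_i[g^{jk}(y^m\partial_m\bar\partial_kL-\partial_kL)]$; $F$ is of Berwald type if $N^k_i=\Gamma^k_{ij}(x)y^j$ on $\mathcal A$, and then $\Gamma^k_{ij}$ are the Christoffel symbols of a torsion-free affine connection on $M$, called the affine connection of $F$. $(\alpha,\beta)$-metrics: $a_{ij}$ is a pseudo-Riemannian metric on $M$, $b=b_i\,dx^i$ a smooth 1-form, $A=a_{ij}y^iy^j$, $\alpha=\sqrt{|A|}$, $\beta=b_iy^i$, $s=\beta/\alpha$, $\epsilon=\operatorname{sgn}(A)$, $\mathring\nabla$ the Levi-Civita connection of $a_{ij}$; indices are raised and lowered with $a_{ij}$ (so $y_j=a_{jk}y^k$). An $(\alpha,\beta)$-metric is a Finsler metric, on a conic subbundle $\mathcal A$ on which $\alpha\ne0$, that can be written as $F=\alpha\phi(\beta/\alpha)$ with $\phi$ a function of one real variable, smooth on its domain. $\phi,\phi'$ are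 evaluated at $s=\beta/\alpha$. *)

theory Defs
  imports "HOL-Analysis.Analysis"
begin

section \<open>Smooth maps between open subsets of normed spaces\<close>

text \<open>Intended for open \<open>S\<close>: \<open>Ck_on S k f\<close> says that all iterated directional derivatives of
  order at most \<open>k\<close> exist (as Frechet derivatives) and are continuous on \<open>S\<close>.
  Values of \<open>f\<close> outside \<open>S\<close> are irrelevant.\<close>

primrec Ck_on ::
    "'a::real_normed_vector set \<Rightarrow> nat \<Rightarrow> ('a \<Rightarrow> 'b::real_normed_vector) \<Rightarrow> bool" where
  "Ck_on S 0 f \<longleftrightarrow> continuous_on S f"
| "Ck_on S (Suc k) f \<longleftrightarrow>
     (\<forall>x\<in>S. f differentiable (at x)) \<and> (\<forall>v. Ck_on S k (\<lambda>x. frechet_derivative f (at x) v))"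

definition smooth_on ::
    "'a::real_normed_vector set \<Rightarrow> ('a \<Rightarrow> 'b::real_normed_vector) \<Rightarrow> bool" where
  "smooth_on S f \<longleftrightarrow> (\<forall>k. Ck_on S k f)"

text \<open>\<open>pd i f x\<close> is the partial derivative along the \<open>i\<close>-th coordinate. For functions of \<open>(x, y)\<close>,
  \<open>hpd i\<close> is the derivative along \<open>x\<^sup>i\<close> and \<open>vpd i\<close> the one along \<open>y\<^sup>i\<close>.\<close>

definition pd :: "'n \<Rightarrow> (real^'n \<Rightarrow> 'b::real_normed_vector) \<Rightarrow> real^'n \<Rightarrow> 'b" where
  "pd i f x = frechet_derivative f (at x) (axis i 1)"

definition hpd :: "'n \<Rightarrow> ((real^'n) \<times> (real^'n) \<Rightarrow> real) \<Rightarrow> (real^'n) \<times> (real^'n) \<Rightarrow> real" where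
  "hpd i f z = frechet_derivative f (at z) (axis i 1, 0)"

definition vpd :: "'n \<Rightarrow> ((real^'n) \<times> (real^'n) \<Rightarrow> real) \<Rightarrow> (real^'n) \<times> (real^'n) \<Rightarrow> real" where
  "vpd i f z = frechet_derivative f (at z) (0, axis i 1)"


section \<open>Smooth manifolds\<close>

text \<open>A chart is a coordinate domain together with a coordinate map, whose values outside
  the domain are irrelevant. The dimension is \<open>CARD('n)\<close>.\<close>

type_synonym ('m, 'n) chart = "'m set \<times> ('m \<Rightarrow> real^'n)"

definition chart_image :: "('m, 'n::finite) chart \<Rightarrow> (real^'n) set" where
  "chart_image c = snd c ` fst c"

definition chart_overlap :: "('m, 'n::finite) chart \<Rightarrow> ('m, 'n) chart \<Rightarrow> (real^'n) set" where
  "chart_overlap c c' = snd c ` (fst c \<inter> fst c')"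

definition transition ::
    "('m, 'n::finite) chart \<Rightarrow> ('m, 'n) chart \<Rightarrow> real^'n \<Rightarrow> real^'n" where
  "transition c c' = snd c' \<circ> inv_into (fst c) (snd c)"

text \<open>The carrier of the manifold is \<open>topspace X\<close>; the atlas is not required to be maximal.\<close>

definition smooth_manifold :: "'m topology \<Rightarrow> ('m, 'n::finite) chart set \<Rightarrow> bool" where
  "smooth_manifold X \<C> \<longleftrightarrow>
     Hausdorff_space X \<and> second_countable X \<and>
     (\<Union>c\<in>\<C>. fst c) = topspace X \<and>
     (\<forall>c\<in>\<C>. openin X (fst c) \<and> open (chart_image c) \<and>
        homeomorphic_map (subtopology X (fst c)) (top_of_set (chart_image c)) (snd c)) \<and>
     (\<forall>c\<in>\<C>. \<forall>c'\<in>\<C>. smooth_on (chart_overlap c c') (transition c c'))"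


section \<open>Tangent bundle\<close>

text \<open>A tangent vector is a base point \<open>p\<close> together with its components \<open>v c\<close> in every chart \<open>c\<close>
  of the atlas around \<open>p\<close>, related by the Jacobians of the chart transitions. For all other
  \<open>c\<close> the value \<open>v c\<close> is normalised to \<open>0\<close>, so that equality is equality of tangent vectors.\<close>

type_synonym ('m, 'n) tvec = "'m \<times> (('m, 'n) chart \<Rightarrow> real^'n)"

definition tangent_bundle :: "('m, 'n::finite) chart set \<Rightarrow> ('m, 'n) tvec set" where
  "tangent_bundle \<C> = {(p, v).
     p \<in> (\<Union>c\<in>\<C>. fst c) \<and>
     (\<forall>c\<in>\<C>. \<forall>c'\<in>\<C>. p \<in> fst c \<inter> fst c' \<longrightarrow>
        v c' = frechet_derivative (transition c c') (at (snd c p)) (v c)) \<and>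
     (\<forall>c. \<not> (c \<in> \<C> \<and> p \<in> fst c) \<longrightarrow> v c = 0)}"

definition tscale :: "real \<Rightarrow> ('m, 'n::finite) tvec \<Rightarrow> ('m, 'n) tvec" where
  "tscale r w = (fst w, \<lambda>c. r *\<^sub>R snd w c)"

text \<open>The coordinates \<open>(x\<^sup>i, y\<^sup>i)\<close> on the tangent bundle induced by the chart \<open>c\<close>, the image of a
  set of tangent vectors in these coordinates, and the expression of a function in them.\<close>

definition tdom :: "('m, 'n::finite) chart set \<Rightarrow> ('m, 'n) chart \<Rightarrow> ('m, 'n) tvec set" where
  "tdom \<C> c = {w \<in> tangent_bundle \<C>. fst w \<in> fst c}"

definition tcoord :: "('m, 'n::finite) chart \<Rightarrow> ('m, 'n) tvec \<Rightarrow> (real^'n) \<times> (real^'n)" where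
  "tcoord c w = (snd c (fst w), snd w c)"

definition in_coords ::
    "('m, 'n::finite) chart set \<Rightarrow> ('m, 'n) chart \<Rightarrow> ('m, 'n) tvec set \<Rightarrow> ((real^'n) \<times> (real^'n)) set" where
  "in_coords \<C> c A = tcoord c ` (A \<inter> tdom \<C> c)"

definition fun_in_coords ::
    "('m, 'n::finite) chart set \<Rightarrow> ('m, 'n) chart \<Rightarrow> (('m, 'n) tvec \<Rightarrow> real) \<Rightarrow>
     (real^'n) \<times> (real^'n) \<Rightarrow> real" where
  "fun_in_coords \<C> c F = F \<circ> inv_into (tdom \<C> c) (tcoord c)"

definition conic_subbundle :: "('m, 'n::finite) chart set \<Rightarrow> ('m, 'n) tvec set \<Rightarrow> bool" where
  "conic_subbundle \<C> A \<longleftrightarrow>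
     A \<subseteq> tangent_bundle \<C> \<and>
     (\<forall>c\<in>\<C>. open (in_coords \<C> c A)) \<and>
     fst ` A = (\<Union>c\<in>\<C>. fst c) \<and>
     (\<forall>w\<in>A. \<forall>r>0. tscale r w \<in> A)"


section \<open>Tensor fields and affine connections\<close>

text \<open>Tensor fields are given by their components in every chart of the atlas, subject to the
  tensorial transformation law. With \<open>x' = transition c c' x\<close>, \<open>dtr c c' i k x\<close> is
  \<open>\<partial>x'\<^sup>k / \<partial>x\<^sup>i\<close>.\<close>

definition dtr ::
    "('m, 'n::finite) chart \<Rightarrow> ('m, 'n) chart \<Rightarrow> 'n \<Rightarrow> 'n \<Rightarrow> real^'n \<Rightarrow> real" where
  "dtr c c' i k x = pd i (\<lambda>x. transition c c' x $ k) x"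

definition one_form ::
    "('m, 'n::finite) chart set \<Rightarrow> (('m, 'n) chart \<Rightarrow> real^'n \<Rightarrow> real^'n) \<Rightarrow> bool" where
  "one_form \<C> b \<longleftrightarrow>
     (\<forall>c\<in>\<C>. smooth_on (chart_image c) (b c)) \<and>
     (\<forall>c\<in>\<C>. \<forall>c'\<in>\<C>. \<forall>x\<in>chart_overlap c c'. \<forall>i.
        b c x $ i = (\<Sum>k\<in>UNIV. dtr c c' i k x * b c' (transition c c' x) $ k))"

definition pseudo_riemannian_metric ::
    "('m, 'n::finite) chart set \<Rightarrow> (('m, 'n) chart \<Rightarrow> real^'n \<Rightarrow> real^'n^'n) \<Rightarrow> bool" where
  "pseudo_riemannian_metric \<C> a \<longleftrightarrow>
     (\<forall>c\<in>\<C>. smooth_on (chart_image c) (a c)) \<and>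
     (\<forall>c\<in>\<C>. \<forall>c'\<in>\<C>. \<forall>x\<in>chart_overlap c c'. \<forall>i j.
        a c x $ i $ j = (\<Sum>k\<in>UNIV. \<Sum>l\<in>UNIV.
          dtr c c' i k x * dtr c c' j l x * a c' (transition c c' x) $ k $ l)) \<and>
     (\<forall>c\<in>\<C>. \<forall>x\<in>chart_image c. (\<forall>i j. a c x $ i $ j = a c x $ j $ i) \<and> invertible (a c x))"

text \<open>\<open>T c x $ j $ i $ k\<close> is \<open>T\<^sup>j\<^sub>i\<^sub>k\<close>, and likewise for connection coefficients.\<close>

definition symmetric_tensor12 ::
    "('m, 'n::finite) chart set \<Rightarrow> (('m, 'n) chart \<Rightarrow> real^'n \<Rightarrow> real^'n^'n^'n) \<Rightarrow> bool" where
  "symmetric_tensor12 \<C> T \<longleftrightarrow>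
     (\<forall>c\<in>\<C>. smooth_on (chart_image c) (T c)) \<and>
     (\<forall>c\<in>\<C>. \<forall>c'\<in>\<C>. \<forall>x\<in>chart_overlap c c'. \<forall>m i k.
        (\<Sum>j\<in>UNIV. dtr c c' j m x * T c x $ j $ i $ k) =
        (\<Sum>p\<in>UNIV. \<Sum>q\<in>UNIV.
           dtr c c' i p x * dtr c c' k q x * T c' (transition c c' x) $ m $ p $ q)) \<and>
     (\<forall>c\<in>\<C>. \<forall>x\<in>chart_image c. \<forall>j i k. T c x $ j $ i $ k = T c x $ j $ k $ i)"

definition torsion_free_affine_connection ::
    "('m, 'n::finite) chart set \<Rightarrow> (('m, 'n) chart \<Rightarrow> real^'n \<Rightarrow> real^'n^'n^'n) \<Rightarrow> bool" where
  "torsion_free_affine_connection \<C> \<Gamma> \<longleftrightarrow>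
     (\<forall>c\<in>\<C>. smooth_on (chart_image c) (\<Gamma> c)) \<and>
     (\<forall>c\<in>\<C>. \<forall>c'\<in>\<C>. \<forall>x\<in>chart_overlap c c'. \<forall>m i k.
        (\<Sum>j\<in>UNIV. dtr c c' j m x * \<Gamma> c x $ j $ i $ k) =
        pd i (dtr c c' k m) x +
        (\<Sum>p\<in>UNIV. \<Sum>q\<in>UNIV.
           dtr c c' i p x * dtr c c' k q x * \<Gamma> c' (transition c c' x) $ m $ p $ q)) \<and>
     (\<forall>c\<in>\<C>. \<forall>x\<in>chart_image c. \<forall>j i k. \<Gamma> c x $ j $ i $ k = \<Gamma> c x $ j $ k $ i)"

text \<open>Levi-Civita Christoffel symbols of the metric with components \<open>a\<close> in a fixed chart, and the
  covariant derivative \<open>\<nabla>\<^sub>i b\<^sub>j\<close> of a 1-form.\<close>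

definition levi_civita :: "(real^'n \<Rightarrow> real^'n^'n) \<Rightarrow> real^'n \<Rightarrow> real^'n^'n^'n::finite" where
  "levi_civita a x = (\<chi> j i k. (1/2) * (\<Sum>l\<in>UNIV. matrix_inv (a x) $ j $ l *
     (pd i (\<lambda>x. a x $ l $ k) x + pd k (\<lambda>x. a x $ l $ i) x - pd l (\<lambda>x. a x $ i $ k) x)))"

definition cov_deriv ::
    "(real^'n \<Rightarrow> real^'n^'n) \<Rightarrow> (real^'n \<Rightarrow> real^'n) \<Rightarrow> 'n \<Rightarrow> 'n \<Rightarrow> real^'n::finite \<Rightarrow> real" where
  "cov_deriv a b i j x =
     pd i (\<lambda>x. b x $ j) x - (\<Sum>k\<in>UNIV. levi_civita a x $ k $ i $ j * b x $ k)"


section \<open>Finsler metrics and the Berwald property\<close>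

text \<open>Here \<open>L\<close> is the coordinate expression of \<open>F\<^sup>2\<close>; \<open>nonlinear_connection L j i\<close> is \<open>N\<^sup>j\<^sub>i\<close>.\<close>

definition fundamental_tensor ::
    "((real^'n) \<times> (real^'n) \<Rightarrow> real) \<Rightarrow> (real^'n) \<times> (real^'n) \<Rightarrow> real^'n^'n::finite" where
  "fundamental_tensor L z = (\<chi> i j. (1/2) * vpd i (vpd j L) z)"

definition nonlinear_connection ::
    "((real^'n) \<times> (real^'n) \<Rightarrow> real) \<Rightarrow> 'n \<Rightarrow> 'n \<Rightarrow> (real^'n::finite) \<times> (real^'n) \<Rightarrow> real" where
  "nonlinear_connection L j i z = (1/4) *
     vpd i (\<lambda>z. \<Sum>k\<in>UNIV. matrix_inv (fundamental_tensor L z) $ j $ k *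
       ((\<Sum>m\<in>UNIV. snd z $ m * hpd m (vpd k L) z) - hpd k L z)) z"

definition L_in_coords ::
    "('m, 'n::finite) chart set \<Rightarrow> ('m, 'n) chart \<Rightarrow> (('m, 'n) tvec \<Rightarrow> real) \<Rightarrow>
     (real^'n) \<times> (real^'n) \<Rightarrow> real" where
  "L_in_coords \<C> c F = fun_in_coords \<C> c (\<lambda>w. (F w)\<^sup>2)"

text \<open>Only the values of \<open>F\<close> on \<open>A\<close> matter.\<close>

definition finsler_metric ::
    "('m, 'n::finite) chart set \<Rightarrow> ('m, 'n) tvec set \<Rightarrow> (('m, 'n) tvec \<Rightarrow> real) \<Rightarrow> bool" where
  "finsler_metric \<C> A F \<longleftrightarrow>
     (\<forall>c\<in>\<C>. smooth_on (in_coords \<C> c A) (fun_in_coords \<C> c F)) \<and>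
     (\<forall>w\<in>A. \<forall>r>0. F (tscale r w) = r * F w) \<and>
     (\<forall>c\<in>\<C>. \<forall>z\<in>in_coords \<C> c A. invertible (fundamental_tensor (L_in_coords \<C> c F) z))"

text \<open>\<open>represents_N \<C> A F \<Gamma>\<close>: \<open>N\<^sup>k\<^sub>i = \<Gamma>\<^sup>k\<^sub>i\<^sub>j(x) y\<^sup>j\<close> on \<open>A\<close>, in every chart.\<close>

definition represents_N ::
    "('m, 'n::finite) chart set \<Rightarrow> ('m, 'n) tvec set \<Rightarrow> (('m, 'n) tvec \<Rightarrow> real) \<Rightarrow>
     (('m, 'n) chart \<Rightarrow> real^'n \<Rightarrow> real^'n^'n^'n) \<Rightarrow> bool" where
  "represents_N \<C> A F \<Gamma> \<longleftrightarrow>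
     (\<forall>c\<in>\<C>. \<forall>(x, y)\<in>in_coords \<C> c A. \<forall>k i.
        nonlinear_connection (L_in_coords \<C> c F) k i (x, y) =
        (\<Sum>j\<in>UNIV. \<Gamma> c x $ k $ i $ j * y $ j))"

definition berwald_type ::
    "('m, 'n::finite) chart set \<Rightarrow> ('m, 'n) tvec set \<Rightarrow> (('m, 'n) tvec \<Rightarrow> real) \<Rightarrow> bool" where
  "berwald_type \<C> A F \<longleftrightarrow> (\<exists>\<Gamma>. represents_N \<C> A F \<Gamma>)"

definition affine_connection_of ::
    "('m, 'n::finite) chart set \<Rightarrow> ('m, 'n) tvec set \<Rightarrow> (('m, 'n) tvec \<Rightarrow> real) \<Rightarrow>
     (('m, 'n) chart \<Rightarrow> real^'n \<Rightarrow> real^'n^'n^'n) \<Rightarrow> bool" where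
  "affine_connection_of \<C> A F \<Gamma> \<longleftrightarrow>
     torsion_free_affine_connection \<C> \<Gamma> \<and> represents_N \<C> A F \<Gamma>"


section \<open>\<open>(\<alpha>,\<beta>)\<close>-metrics\<close>

text \<open>The arguments are the components of the metric and the 1-form at a point \<open>x\<close> of a chart,
  and the components \<open>y\<close> of a tangent vector.\<close>

definition quad :: "real^'n^'n \<Rightarrow> real^'n::finite \<Rightarrow> real" where
  "quad a y = (\<Sum>i\<in>UNIV. \<Sum>j\<in>UNIV. a $ i $ j * y $ i * y $ j)"

definition alpha :: "real^'n^'n \<Rightarrow> real^'n::finite \<Rightarrow> real" where
  "alpha a y = sqrt \<bar>quad a y\<bar>"

definition beta :: "real^'n \<Rightarrow> real^'n::finite \<Rightarrow> real" where
  "beta b y = (\<Sum>i\<in>UNIV. b $ i * y $ i)"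

definition lower :: "real^'n^'n \<Rightarrow> real^'n \<Rightarrow> 'n::finite \<Rightarrow> real" where
  "lower a y j = (\<Sum>k\<in>UNIV. a $ j $ k * y $ k)"

text \<open>The domain \<open>D\<close> of \<open>\<phi>\<close> is an open set of reals containing all values of \<open>\<beta>/\<alpha>\<close> on \<open>A\<close>.\<close>

definition alpha_beta_metric ::
    "('m, 'n::finite) chart set \<Rightarrow> ('m, 'n) tvec set \<Rightarrow>
     (('m, 'n) chart \<Rightarrow> real^'n \<Rightarrow> real^'n^'n) \<Rightarrow> (('m, 'n) chart \<Rightarrow> real^'n \<Rightarrow> real^'n) \<Rightarrow>
     real set \<Rightarrow> (real \<Rightarrow> real) \<Rightarrow> (('m, 'n) tvec \<Rightarrow> real) \<Rightarrow> bool" where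
  "alpha_beta_metric \<C> A a b D \<phi> F \<longleftrightarrow>
     finsler_metric \<C> A F \<and> open D \<and> smooth_on D \<phi> \<and>
     (\<forall>c\<in>\<C>. \<forall>w \<in> A \<inter> tdom \<C> c. case tcoord c w of (x, y) \<Rightarrow>
        alpha (a c x) y \<noteq> 0 \<and>
        beta (b c x) y / alpha (a c x) y \<in> D \<and>
        F w = alpha (a c x) y * \<phi> (beta (b c x) y / alpha (a c x) y))"

definition berwald_condition ::
    "('m, 'n::finite) chart set \<Rightarrow> ('m, 'n) tvec set \<Rightarrow>
     (('m, 'n) chart \<Rightarrow> real^'n \<Rightarrow> real^'n^'n) \<Rightarrow> (('m, 'n) chart \<Rightarrow> real^'n \<Rightarrow> real^'n) \<Rightarrow>
     (real \<Rightarrow> real) \<Rightarrow> (('m, 'n) chart \<Rightarrow> real^'n \<Rightarrow> real^'n^'n^'n) \<Rightarrow> bool" where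
  "berwald_condition \<C> A a b \<phi> T \<longleftrightarrow>
     (\<forall>c\<in>\<C>. \<forall>(x, y)\<in>in_coords \<C> c A.
        let \<alpha> = alpha (a c x) y; \<beta> = beta (b c x) y; s = \<beta> / \<alpha>; \<epsilon> = sgn (quad (a c x) y) in
        (deriv \<phi> s \<noteq> 0 \<longrightarrow> (\<forall>i.
           (\<Sum>j\<in>UNIV. y $ j * cov_deriv (a c) (b c) i j x) =
           (\<Sum>j\<in>UNIV. \<Sum>k\<in>UNIV. T c x $ j $ i $ k * y $ k *
              (b c x $ j + \<epsilon> / \<alpha> * (\<phi> s / deriv \<phi> s - \<beta> / \<alpha>) * lower (a c x) y j)))) \<and>
        (deriv \<phi> s = 0 \<longrightarrow> (\<forall>i.
           (\<Sum>j\<in>UNIV. \<Sum>k\<in>UNIV. T c x $ j $ i $ k * y $ k * lower (a c x) y j) = 0)))"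

end

theory Submission
  imports Defs
begin

text \<open>Write \<open>\<delta>\<^sub>i = \<partial>\<^sub>i - \<Gamma>\<^sup>j\<^sub>i\<^sub>k y\<^sup>k \<partial>\<^sub>y\<^sub>j\<close> for a symmetric \<open>\<Gamma>(x)\<close>. The nonlinear connection of a homogeneous
  Lagrangian \<open>L\<close> is \<open>\<Gamma>\<^sup>k\<^sub>i\<^sub>j y\<^sup>j\<close> if and only if \<open>\<delta>\<^sub>i L = 0\<close> for all \<open>i\<close>. Since the latter condition is natural
  under changes of coordinates and determines \<open>\<Gamma>\<close>, the coefficients transform as an affine
  connection. The Levi-Civita connection is the case \<open>L = a\<^sub>i\<^sub>j y\<^sup>i y\<^sup>j\<close> on the whole tangent bundle.
  For \<open>L = F\<^sup>2\<close> with \<open>F = \<alpha> \<phi>(\<beta>/\<alpha>)\<close> and \<open>\<Gamma>\<close> the sum of the Levi-Civita symbols and \<open>T\<close>, expanding \<open>\<delta>\<^sub>i L\<close>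
  turns \<open>\<delta>\<^sub>i L = 0\<close> into the stated equation; here \<open>\<phi> \<noteq> 0\<close>, because nondegeneracy of
  the fundamental tensor excludes zeros of \<open>F\<close>.\<close>

section \<open>Calculus of smooth maps\<close>

text \<open>\<open>berwald_type\<close> supplies, in each chart separately, bare coefficients with
  \<open>N = \<Gamma> y\<close>: neither smoothness, nor symmetry in the lower indices, nor any
  relation between charts. All three must be derived before the difference from the Levi-Civita
  symbols can be called a tensor field. Transforming N itself would mean handling an inverse Hessian
  and third derivatives of L, whereas \<open>\<delta>\<^sub>i L = 0\<close> is of first order and
  passes between charts by one use of the chain rule. The passage from identities in y to statements
  about the coefficients at x rests on the cone having a nonempty open fibre over every x: a linear
  form in y that vanishes there is zero. The expansion for F simplifies because the Levi-Civita part
  of \<open>\<delta>\<^sub>i\<close> kills the quadratic form and turns \<beta> into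
  \<open>y\<^sup>j \<nabla>\<^sub>i b\<^sub>j\<close>, so T accounts for all other terms. Before
  division by \<phi>' the two cases of the stated condition are one equation; at \<phi>' = 0 it says
  that \<epsilon> \<phi> / \<alpha> times
  \<open>T\<^sup>j\<^sub>i\<^sub>k y\<^sup>k y\<^sub>j\<close> is zero.\<close>

abbreviation fd :: "('a::real_normed_vector \<Rightarrow> 'b::real_normed_vector) \<Rightarrow> 'a \<Rightarrow> 'a \<Rightarrow> 'b" where
  "fd f x \<equiv> frechet_derivative f (at x)"

section \<open>Locality of derivatives and of the classes \<open>Ck_on\<close>\<close>

lemma fd_eqI: "(f has_derivative f') (at x) \<Longrightarrow> fd f x = f'"
  by (metis frechet_derivative_at)

text \<open>\<open>frechet_derivative\<close> is a choice among the derivatives that exist. Both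
  functions have the same derivatives at \<open>x\<close>, hence the same choice, even where there
  is none.\<close>

lemma fd_cong:
  assumes "open S" "x \<in> S" "\<And>x. x \<in> S \<Longrightarrow> f x = g x"
  shows "fd f x = fd g x"
proof -
  have "(f has_derivative d) (at x) \<longleftrightarrow> (g has_derivative d) (at x)" for d
    using has_derivative_transform_within_open[OF _ assms(1,2), where f=f and g=g and t=UNIV and f'=d]
      has_derivative_transform_within_open[OF _ assms(1,2), where f=g and g=f and t=UNIV and f'=d] assms(3)
    by metis
  then show ?thesis by (simp add: frechet_derivative_def)
qed

lemma differentiable_cong_open:
  assumes "open S" "x \<in> S" "\<And>x. x \<in> S \<Longrightarrow> f x = g x" "f differentiable at x"
  shows "g differentiable at x"
  using has_derivative_transform_within_open[OF _ assms(1,2), where f=f and g=g and t=UNIV] assms(3,4)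
  unfolding differentiable_def by metis

text \<open>The derivative of a compound expression is known by formula on \<open>S\<close> only;
  the inductions on \<open>k\<close> below replace it by that formula through this lemma.\<close>

lemma Ck_on_cong:
  assumes "open S" "\<And>x. x \<in> S \<Longrightarrow> f x = g x" "Ck_on S k f"
  shows "Ck_on S k g"
  using assms(2,3)
proof (induction k arbitrary: f g)
  case 0
  then show ?case by (simp cong: continuous_on_cong)
next
  case (Suc k)
  have "Ck_on S k (\<lambda>x. fd g x v)" for v
    by (rule Suc.IH[of "\<lambda>x. fd f x v"])
      (use Suc.prems fd_cong[OF assms(1), of _ f g] in auto)
  moreover have "g differentiable at x" if "x \<in> S" for x
    by (rule differentiable_cong_open[OF assms(1) that Suc.prems(1)]) (use Suc.prems that in auto)
  ultimately show ?case by simp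
qed

lemma Ck_on_subset: "Ck_on S k f \<Longrightarrow> T \<subseteq> S \<Longrightarrow> Ck_on T k f"
  by (induction k arbitrary: f) (auto intro: continuous_on_subset)

lemma Ck_on_continuous: "Ck_on S k f \<Longrightarrow> continuous_on S f"
  by (cases k) (auto intro!: continuous_at_imp_continuous_on differentiable_imp_continuous_within)

lemma Ck_on_le: "Ck_on S (Suc k) f \<Longrightarrow> Ck_on S k f"
  by (induction k arbitrary: f) (use Ck_on_continuous[of S "Suc 0"] in auto)

lemma Ck_on_local:
  assumes "\<And>x. x \<in> S \<Longrightarrow> \<exists>U. open U \<and> x \<in> U \<and> Ck_on U k f"
  shows "Ck_on S k f"
  using assms
proof (induction k arbitrary: f)
  case 0
  have "isCont f x" if "x \<in> S" for x
    using 0[OF that] by (auto simp: continuous_on_eq_continuous_at)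
  then show ?case by (simp add: continuous_at_imp_continuous_on)
next
  case (Suc k)
  have "Ck_on S k (\<lambda>x. fd f x v)" for v
    by (rule Suc.IH) (use Suc.prems in fastforce)
  then show ?case using Suc.prems by fastforce
qed

section \<open>Closure properties of \<open>Ck_on\<close>\<close>

lemma Ck_on_const: "Ck_on S k (\<lambda>x. c)"
  by (induction k arbitrary: c) simp_all

lemma Ck_on_bounded_linear_comp:
  assumes "bounded_linear h" "open S" "Ck_on S k f"
  shows "Ck_on S k (\<lambda>x. h (f x))"
  using assms(3)
proof (induction k arbitrary: f)
  case 0
  then show ?case using bounded_linear.continuous_on[OF assms(1)] by auto
next
  case (Suc k)
  have d: "((\<lambda>x. h (f x)) has_derivative (\<lambda>v. h (fd f x v))) (at x)" if "x \<in> S" for x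
    by (rule bounded_linear.has_derivative[OF assms(1)])
      (use Suc.prems that in \<open>auto simp flip: frechet_derivative_works\<close>)
  have "Ck_on S k (\<lambda>x. fd (\<lambda>x. h (f x)) x v)" for v
    by (rule Ck_on_cong[OF assms(2) _ Suc.IH[of "\<lambda>x. fd f x v"]])
      (use fd_eqI[OF d] Suc.prems in auto)
  then show ?case using d by (auto simp: differentiable_def)
qed

lemma Ck_on_bounded_linear:
  assumes "bounded_linear h"
  shows "Ck_on S k h"
proof (cases k)
  case 0
  then show ?thesis by (simp add: assms linear_continuous_on)
next
  case (Suc j)
  have "(h has_derivative h) (at x)" for x
    using assms by (rule bounded_linear_imp_has_derivative)
  then show ?thesis using Suc fd_eqI[of h h]
    by (auto simp: differentiable_def Ck_on_const)
qed

lemma Ck_on_add: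
  assumes "open S" "Ck_on S k f" "Ck_on S k g"
  shows "Ck_on S k (\<lambda>x. f x + g x)"
  using assms(2,3)
proof (induction k arbitrary: f g)
  case 0
  then show ?case by (auto intro: continuous_intros)
next
  case (Suc k)
  have d: "((\<lambda>x. f x + g x) has_derivative (\<lambda>v. fd f x v + fd g x v)) (at x)" if "x \<in> S" for x
    by (rule has_derivative_add) (use Suc.prems that in \<open>auto simp flip: frechet_derivative_works\<close>)
  have "Ck_on S k (\<lambda>x. fd (\<lambda>x. f x + g x) x v)" for v
    by (rule Ck_on_cong[OF assms(1) _ Suc.IH[of "\<lambda>x. fd f x v" "\<lambda>x. fd g x v"]])
      (use fd_eqI[OF d] Suc.prems in auto)
  then show ?case using d by (auto simp: differentiable_def)
qed

lemma Ck_on_bilinear: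
  assumes "bounded_bilinear h" "open S" "Ck_on S k f" "Ck_on S k g"
  shows "Ck_on S k (\<lambda>x. h (f x) (g x))"
  using assms(3,4)
proof (induction k arbitrary: f g)
  case 0
  then show ?case using bounded_bilinear.continuous_on[OF assms(1)] by auto
next
  case (Suc k)
  have d: "((\<lambda>x. h (f x) (g x)) has_derivative (\<lambda>v. h (f x) (fd g x v) + h (fd f x v) (g x))) (at x)"
    if "x \<in> S" for x
    by (rule bounded_bilinear.FDERIV[OF assms(1)])
      (use Suc.prems that in \<open>auto simp flip: frechet_derivative_works\<close>)
  have "Ck_on S k (\<lambda>x. fd (\<lambda>x. h (f x) (g x)) x v)" for v
    by (rule Ck_on_cong[OF assms(2) _ Ck_on_add[OF assms(2) Suc.IH[of f "\<lambda>x. fd g x v"] Suc.IH[of "\<lambda>x. fd f x v" g]]])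
      (use fd_eqI[OF d] Suc.prems Ck_on_le in auto)
  then show ?case using d by (auto simp: differentiable_def)
qed

lemma Ck_on_sum:
  assumes "open S" "\<And>i. i \<in> I \<Longrightarrow> Ck_on S k (f i)"
  shows "Ck_on S k (\<lambda>x. \<Sum>i\<in>I. f i x)"
  using assms(2)
  by (induction I rule: infinite_finite_induct) (auto intro: Ck_on_add[OF assms(1)] simp: Ck_on_const)

lemma fd_euclidean:
  fixes f :: "'a::euclidean_space \<Rightarrow> 'b::real_normed_vector"
  assumes "f differentiable at x"
  shows "fd f x v = (\<Sum>b\<in>Basis. (v \<bullet> b) *\<^sub>R fd f x b)"
proof -
  interpret linear "fd f x" by (rule linear_frechet_derivative[OF assms])
  have "fd f x v = fd f x (\<Sum>b\<in>Basis. (v \<bullet> b) *\<^sub>R b)" by (simp add: euclidean_representation)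
  then show ?thesis by (simp add: sum scale)
qed

text \<open>\<open>Ck_on\<close> controls derivatives in fixed directions, but the chain rule
  produces \<open>fd f (g x)\<close> in the direction \<open>fd g x v\<close>, which moves with
  \<open>x\<close>. Expanding this direction in a basis leaves fixed directions with varying scalar
  coefficients; here finite dimension enters.\<close>

lemma Ck_on_compose:
  fixes f :: "'b::euclidean_space \<Rightarrow> 'c::real_normed_vector"
  assumes "open S" "open T" "Ck_on T k f" "Ck_on S k g" "g ` S \<subseteq> T"
  shows "Ck_on S k (\<lambda>x. f (g x))"
  using assms(3-)
proof (induction k arbitrary: f g)
  case 0
  then show ?case by (auto intro: continuous_on_compose2)
next
  case (Suc k)
  have d: "((\<lambda>x. f (g x)) has_derivative (\<lambda>v. fd f (g x) (fd g x v))) (at x)" if "x \<in> S" for x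
    by (rule has_derivative_compose)
      (use Suc.prems that in \<open>auto simp: image_subset_iff simp flip: frechet_derivative_works\<close>)
  have e: "fd (\<lambda>x. f (g x)) x v = (\<Sum>b\<in>Basis. (fd g x v \<bullet> b) *\<^sub>R fd f (g x) b)"
    if "x \<in> S" for x v
    unfolding fd_eqI[OF d[OF that]] by (rule fd_euclidean) (use Suc.prems that in auto)
  have "Ck_on S k (\<lambda>x. fd (\<lambda>x. f (g x)) x v)" for v
  proof (rule Ck_on_cong[OF assms(1)])
    show "Ck_on S k (\<lambda>x. \<Sum>b\<in>Basis. (fd g x v \<bullet> b) *\<^sub>R fd f (g x) b)"
    proof (intro Ck_on_sum assms Ck_on_bilinear[OF bounded_bilinear_scaleR])
      fix b :: 'b assume "b \<in> Basis"
      show "Ck_on S k (\<lambda>x. fd g x v \<bullet> b)"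
        by (rule Ck_on_bounded_linear_comp[OF bounded_linear_inner_left assms(1)]) (use Suc.prems in auto)
      show "Ck_on S k (\<lambda>x. fd f (g x) b)"
        by (rule Suc.IH[of "\<lambda>x. fd f x b"]) (use Suc.prems Ck_on_le[OF Suc.prems(2)] in auto)
    qed
  qed (simp add: e)
  then show ?case using d by (auto simp: differentiable_def)
qed

text \<open>The derivative is a product of inverses and a constant, so the induction hypothesis
  applies to it.\<close>

lemma Ck_on_inverse: "Ck_on (- {0}) k (inverse :: real \<Rightarrow> real)"
proof (induction k)
  case 0
  then show ?case by (auto intro!: continuous_intros)
next
  case (Suc k)
  have o: "open (- {0::real})" by (simp add: open_Compl)
  have d: "((inverse :: real \<Rightarrow> real) has_derivative (\<lambda>v. - (inverse x * v * inverse x))) (at x)"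
    if "x \<in> - {0}" for x
    by (rule has_derivative_inverse') (use that in auto)
  have "Ck_on (- {0}) k (\<lambda>x. fd (inverse :: real \<Rightarrow> real) x v)" for v
  proof (rule Ck_on_cong[OF o])
    show "Ck_on (- {0::real}) k (\<lambda>x. inverse x * inverse x *\<^sub>R (- v))"
      by (intro Ck_on_bilinear[OF bounded_bilinear_scaleR o] Ck_on_bilinear[OF bounded_bilinear_mult o]
          Suc Ck_on_const)
    show "inverse x * inverse x *\<^sub>R - v = fd inverse x v" if "x \<in> - {0}" for x
      using fd_eqI[OF d[OF that]] by simp
  qed
  then show ?case using d by (auto simp: differentiable_def)
qed

section \<open>Closure properties of \<open>smooth_on\<close>\<close>

lemma smooth_on_cong: "open S \<Longrightarrow> (\<And>x. x \<in> S \<Longrightarrow> f x = g x) \<Longrightarrow> smooth_on S f \<Longrightarrow> smooth_on S g"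
  unfolding smooth_on_def using Ck_on_cong by blast

lemma smooth_on_subset: "smooth_on S f \<Longrightarrow> T \<subseteq> S \<Longrightarrow> smooth_on T f"
  unfolding smooth_on_def using Ck_on_subset by blast

lemma smooth_on_local:
  "(\<And>x. x \<in> S \<Longrightarrow> \<exists>U. open U \<and> x \<in> U \<and> smooth_on U f) \<Longrightarrow> smooth_on S f"
  unfolding smooth_on_def by (intro allI Ck_on_local) blast

lemma smooth_on_Suc: "smooth_on S f \<Longrightarrow> Ck_on S (Suc k) f"
  by (simp only: smooth_on_def)

lemma smooth_on_fd:
  assumes "smooth_on S f"
  shows "smooth_on S (\<lambda>x. fd f x v)"
  unfolding smooth_on_def using smooth_on_Suc[OF assms] by simp

lemma smooth_on_differentiable: "smooth_on S f \<Longrightarrow> x \<in> S \<Longrightarrow> f differentiable at x"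
  using smooth_on_Suc[of S f 0] by simp

lemma smooth_on_has_derivative: "smooth_on S f \<Longrightarrow> x \<in> S \<Longrightarrow> (f has_derivative fd f x) (at x)"
  using smooth_on_differentiable frechet_derivative_works by blast

lemma smooth_on_continuous_on: "smooth_on S f \<Longrightarrow> continuous_on S f"
  unfolding smooth_on_def using Ck_on_continuous by blast

lemma smooth_on_const: "smooth_on S (\<lambda>x. c)"
  by (simp add: smooth_on_def Ck_on_const)

lemma smooth_on_bounded_linear: "bounded_linear h \<Longrightarrow> smooth_on S h"
  by (simp add: smooth_on_def Ck_on_bounded_linear)

lemma smooth_on_bounded_linear_comp:
  "bounded_linear h \<Longrightarrow> open S \<Longrightarrow> smooth_on S f \<Longrightarrow> smooth_on S (\<lambda>x. h (f x))"
  by (simp add: smooth_on_def Ck_on_bounded_linear_comp)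

lemma smooth_on_add:
  "open S \<Longrightarrow> smooth_on S f \<Longrightarrow> smooth_on S g \<Longrightarrow> smooth_on S (\<lambda>x. f x + g x)"
  by (simp add: smooth_on_def Ck_on_add)

lemma smooth_on_minus: "open S \<Longrightarrow> smooth_on S f \<Longrightarrow> smooth_on S (\<lambda>x. - f x)"
  by (rule smooth_on_bounded_linear_comp[OF bounded_linear_minus[OF bounded_linear_ident]])

lemma smooth_on_diff:
  "open S \<Longrightarrow> smooth_on S f \<Longrightarrow> smooth_on S g \<Longrightarrow> smooth_on S (\<lambda>x. f x - g x)"
  using smooth_on_add[of S f "\<lambda>x. - g x"] smooth_on_minus by auto

lemma smooth_on_mult:
  fixes f g :: "'a::real_normed_vector \<Rightarrow> real"
  shows "open S \<Longrightarrow> smooth_on S f \<Longrightarrow> smooth_on S g \<Longrightarrow> smooth_on S (\<lambda>x. f x * g x)"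
  by (simp add: smooth_on_def Ck_on_bilinear[OF bounded_bilinear_mult])

lemma smooth_on_sum:
  "open S \<Longrightarrow> (\<And>i. i \<in> I \<Longrightarrow> smooth_on S (f i)) \<Longrightarrow> smooth_on S (\<lambda>x. \<Sum>i\<in>I. f i x)"
  by (simp add: smooth_on_def Ck_on_sum)

lemma smooth_on_prod:
  fixes f :: "'i \<Rightarrow> 'a::real_normed_vector \<Rightarrow> real"
  assumes "open S" "\<And>i. i \<in> I \<Longrightarrow> smooth_on S (f i)"
  shows "smooth_on S (\<lambda>x. \<Prod>i\<in>I. f i x)"
  using assms(2)
  by (induction I rule: infinite_finite_induct) (auto intro: smooth_on_mult[OF assms(1)] simp: smooth_on_const)

lemma smooth_on_compose:
  fixes f :: "'b::euclidean_space \<Rightarrow> 'c::real_normed_vector"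
  shows "open S \<Longrightarrow> open T \<Longrightarrow> smooth_on T f \<Longrightarrow> smooth_on S g \<Longrightarrow> g ` S \<subseteq> T \<Longrightarrow> smooth_on S (\<lambda>x. f (g x))"
  by (simp add: smooth_on_def Ck_on_compose)

lemma smooth_on_divide:
  fixes f g :: "'a::real_normed_vector \<Rightarrow> real"
  assumes "open S" "smooth_on S f" "smooth_on S g" "\<And>x. x \<in> S \<Longrightarrow> g x \<noteq> 0"
  shows "smooth_on S (\<lambda>x. f x / g x)"
  unfolding divide_inverse
  by (intro smooth_on_mult smooth_on_compose[of S "- {0}" inverse] assms)
    (use assms in \<open>auto simp: smooth_on_def Ck_on_inverse open_Compl\<close>)

lemma smooth_on_vec_nth: "open S \<Longrightarrow> smooth_on S f \<Longrightarrow> smooth_on S (\<lambda>x. f x $ i)"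
  by (rule smooth_on_bounded_linear_comp[OF bounded_linear_vec_nth])

lemma bounded_linear_axis: "bounded_linear (axis i :: 'a::real_normed_vector \<Rightarrow> 'a^'n::finite)"
  by (rule bounded_linear_intro[where K=1])
    (auto simp: axis_def vec_eq_iff norm_vec_def L2_set_def if_distrib[of norm] if_distrib[of "\<lambda>x. x\<^sup>2"] cong: if_cong)

lemma smooth_on_vec_lambda:
  fixes f :: "'a::real_normed_vector \<Rightarrow> 'n::finite \<Rightarrow> 'b::real_normed_vector"
  assumes "open S" "\<And>i. smooth_on S (\<lambda>x. f x i)"
  shows "smooth_on S (\<lambda>x. \<chi> i. f x i)"
proof -
  have "(\<lambda>x. \<chi> i. f x i) = (\<lambda>x. \<Sum>i\<in>UNIV. axis i (f x i))"
    by (auto simp: vec_eq_iff axis_def fun_eq_iff)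
  then show ?thesis
    using assms by (auto intro!: smooth_on_sum smooth_on_bounded_linear_comp[OF bounded_linear_axis])
qed

lemma smooth_on_Pair:
  assumes "open S" "smooth_on S f" "smooth_on S g"
  shows "smooth_on S (\<lambda>x. (f x, g x))"
proof -
  have "smooth_on S (\<lambda>x. (f x, 0) + (0, g x))"
    by (intro smooth_on_add smooth_on_bounded_linear_comp[of "\<lambda>x. (x, 0)"]
        smooth_on_bounded_linear_comp[of "\<lambda>x. (0, x)"] assms bounded_linear_Pair
        bounded_linear_ident bounded_linear_zero)
  then show ?thesis by simp
qed

section \<open>Determinants and inverse matrices\<close>

lemma smooth_on_det:
  fixes f :: "'a::real_normed_vector \<Rightarrow> real^'n^'n::finite"
  assumes "open S" "\<And>i j. smooth_on S (\<lambda>x. f x $ i $ j)"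
  shows "smooth_on S (\<lambda>x. det (f x))"
  unfolding det_def by (intro smooth_on_sum smooth_on_mult smooth_on_prod smooth_on_const assms)

lemma matrix_inv_both:
  fixes A :: "real^'n^'n::finite"
  assumes "invertible A"
  shows "A ** matrix_inv A = mat 1" "matrix_inv A ** A = mat 1"
proof -
  have "A ** matrix_inv A = mat 1 \<and> matrix_inv A ** A = mat 1"
    unfolding matrix_inv_def by (rule someI_ex) (use assms in \<open>simp add: invertible_def\<close>)
  then show "A ** matrix_inv A = mat 1" "matrix_inv A ** A = mat 1" by auto
qed

text \<open>Cramer's rule for the \<open>k\<close>-th column of the inverse. It exhibits the entries
  as quotients of polynomials in the entries of \<open>A\<close>, which makes inversion
  smooth.\<close>

lemma matrix_inv_cramer:
  fixes A :: "real^'n^'n::finite"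
  assumes "invertible A"
  shows "matrix_inv A $ j $ k = det (\<chi> i l. if l = j then axis k 1 $ i else A $ i $ l) / det A"
proof -
  have inv: "A ** matrix_inv A = mat 1"
    using assms by (rule matrix_inv_both)
  have "A *v (\<chi> j. matrix_inv A $ j $ k) = axis k 1"
  proof -
    have "(A *v (\<chi> j. matrix_inv A $ j $ k)) $ i = (A ** matrix_inv A) $ i $ k" for i
      by (simp add: matrix_vector_mult_def matrix_matrix_mult_def)
    then show ?thesis by (simp add: inv vec_eq_iff mat_def axis_def)
  qed
  moreover have "det A \<noteq> 0" using assms by (simp add: invertible_det_nz)
  ultimately have "(\<chi> j. matrix_inv A $ j $ k) =
      (\<chi> j. det (\<chi> i l. if l = j then axis k 1 $ i else A $ i $ l) / det A)"
    by (simp add: cramer)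
  then show ?thesis by (simp add: vec_eq_iff)
qed

lemma smooth_on_matrix_inv:
  fixes f :: "'a::real_normed_vector \<Rightarrow> real^'n^'n::finite"
  assumes "open S" "\<And>i j. smooth_on S (\<lambda>x. f x $ i $ j)" "\<And>x. x \<in> S \<Longrightarrow> invertible (f x)"
  shows "smooth_on S (\<lambda>x. matrix_inv (f x) $ j $ k)"
proof -
  let ?N = "\<lambda>x. \<chi> i l. if l = j then axis k 1 $ i else f x $ i $ l"
  have "smooth_on S (\<lambda>x. ?N x $ i $ l)" for i l
    by (cases "l = j") (simp_all add: smooth_on_const assms(2))
  then have "smooth_on S (\<lambda>x. det (?N x))"
    by (rule smooth_on_det[OF assms(1)])
  moreover have "smooth_on S (\<lambda>x. det (f x))"
    by (rule smooth_on_det[OF assms(1,2)])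
  moreover have "det (f x) \<noteq> 0" if "x \<in> S" for x
    using assms(3)[OF that] by (simp add: invertible_det_nz)
  ultimately have "smooth_on S (\<lambda>x. det (?N x) / det (f x))"
    by (rule smooth_on_divide[OF assms(1)])
  then show ?thesis
    by (rule smooth_on_cong[OF assms(1), rotated]) (simp only: matrix_inv_cramer[OF assms(3)])
qed

lemmas has_derivative_vec_nth [derivative_intros] = bounded_linear.has_derivative[OF bounded_linear_vec_nth]

section \<open>Symmetry of second derivatives\<close>

lemma line_has_real_derivative:
  assumes "f differentiable at (u + p *\<^sub>R v)"
  shows "((\<lambda>p. f (u + p *\<^sub>R v)) has_real_derivative fd f (u + p *\<^sub>R v) v) (at p)"
proof -
  interpret linear "fd f (u + p *\<^sub>R v)" by (rule linear_frechet_derivative[OF assms])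
  have "((\<lambda>p. f (u + p *\<^sub>R v)) has_derivative (\<lambda>h. fd f (u + p *\<^sub>R v) (h *\<^sub>R v))) (at p)"
    by (rule has_derivative_compose[where f="\<lambda>p. u + p *\<^sub>R v" and g=f])
      (use assms in \<open>auto intro!: derivative_eq_intros simp flip: frechet_derivative_works\<close>)
  then show ?thesis
    by (simp add: scale has_field_derivative_def mult.commute[of _ "fd f (u + p *\<^sub>R v) v"])
qed

text \<open>The mean value theorem is applied along \<open>v\<close> to the difference over the side
  \<open>t *\<^sub>R w\<close>, and then along \<open>w\<close>. The left side is symmetric in
  \<open>v\<close> and \<open>w\<close>, so exchanging them expresses it by the other mixed
  derivative.\<close>

lemma mixed_difference_mvt:
  fixes f :: "'a::real_normed_vector \<Rightarrow> real"
  assumes sm: "smooth_on S f" and t: "t > 0"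
    and seg: "\<And>p q. \<lbrakk>0 \<le> p; p \<le> t; 0 \<le> q; q \<le> t\<rbrakk> \<Longrightarrow> x + p *\<^sub>R v + q *\<^sub>R w \<in> S"
  obtains p q where "0 < p" "p < t" "0 < q" "q < t"
    "f (x + t *\<^sub>R v + t *\<^sub>R w) - f (x + t *\<^sub>R v) - f (x + t *\<^sub>R w) + f x
       = t * t * fd (\<lambda>u. fd f u v) (x + p *\<^sub>R v + q *\<^sub>R w) w"
proof -
  define g where "g p = f (x + p *\<^sub>R v + t *\<^sub>R w) - f (x + p *\<^sub>R v)" for p
  note line = line_has_real_derivative[OF smooth_on_differentiable[OF sm]]
  have "(g has_real_derivative fd f (x + p *\<^sub>R v + t *\<^sub>R w) v - fd f (x + p *\<^sub>R v) v) (at p)"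
    if "0 \<le> p" "p \<le> t" for p
    unfolding g_def
    using line[of "x + t *\<^sub>R w" p] line[of x p] seg[of p t] seg[of p 0] that t
    by (intro DERIV_diff) (simp_all add: algebra_simps)
  from MVT2[OF t this] obtain p where p: "0 < p" "p < t"
    "g t - g 0 = t * (fd f (x + p *\<^sub>R v + t *\<^sub>R w) v - fd f (x + p *\<^sub>R v) v)" by auto
  define k where "k q = fd f (x + p *\<^sub>R v + q *\<^sub>R w) v" for q
  have "(k has_real_derivative fd (\<lambda>u. fd f u v) (x + p *\<^sub>R v + q *\<^sub>R w) w) (at q)"
    if "0 \<le> q" "q \<le> t" for q
  proof -
    have S: "x + p *\<^sub>R v + q *\<^sub>R w \<in> S" using seg p that by simp
    show ?thesis unfolding k_def
      by (rule line_has_real_derivative[OF smooth_on_differentiable[OF smooth_on_fd[OF sm] S]])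
  qed
  from MVT2[OF t this] obtain q where q: "0 < q" "q < t"
    "k t - k 0 = t * fd (\<lambda>u. fd f u v) (x + p *\<^sub>R v + q *\<^sub>R w) w" by auto
  have "g t - g 0 = t * (k t - k 0)" using p(3) by (simp add: k_def)
  then show thesis using that[OF p(1,2) q(1,2)] q(3) by (simp add: g_def algebra_simps)
qed

text \<open>Both mixed derivatives, taken at suitable points near \<open>x\<close>, equal the same
  second difference divided by the square of \<open>t\<close>. Continuity carries the equality to
  \<open>x\<close>.\<close>

lemma fd_fd_commute:
  fixes f :: "'a::real_normed_vector \<Rightarrow> real"
  assumes sm: "smooth_on S f" and S: "open S" "x \<in> S"
  shows "fd (\<lambda>u. fd f u v) x w = fd (\<lambda>u. fd f u w) x v"
proof (rule ccontr)
  let ?P = "\<lambda>u. fd (\<lambda>u. fd f u v) u w" and ?Q = "\<lambda>u. fd (\<lambda>u. fd f u w) u v"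
  assume ne: "?P x \<noteq> ?Q x"
  define e where "e = \<bar>?P x - ?Q x\<bar> / 2"
  have e: "e > 0" using ne by (simp add: e_def)
  have "isCont ?P x" "isCont ?Q x"
    using smooth_on_continuous_on[OF smooth_on_fd[OF smooth_on_fd[OF sm]]] S
    by (auto simp: continuous_on_eq_continuous_at)
  then obtain d1 d2 where d1: "d1 > 0" "\<And>u. dist u x < d1 \<Longrightarrow> dist (?P u) (?P x) < e"
    and d2: "d2 > 0" "\<And>u. dist u x < d2 \<Longrightarrow> dist (?Q u) (?Q x) < e"
    unfolding continuous_at_eps_delta using e by metis
  obtain d3 where d3: "d3 > 0" "\<And>u. dist u x < d3 \<Longrightarrow> u \<in> S"
    using S by (metis open_dist)
  define d where "d = min d1 (min d2 d3)"
  \<comment> \<open>Every point of the parallelogram with sides \<open>t *\<^sub>R v\<close> and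
    \<open>t *\<^sub>R w\<close> is then closer to \<open>x\<close> than \<open>d\<close>; the
    summand 1 covers the case that both vectors are zero.\<close>
  define t where "t = d / (norm v + norm w + 1)"
  have pos: "norm v + norm w + 1 > 0" by (smt (verit) norm_ge_zero)
  have t: "t > 0" using d1 d2 d3 pos by (simp add: t_def d_def)
  have near: "dist (x + p *\<^sub>R v + q *\<^sub>R w) x < d" if "0 \<le> p" "p \<le> t" "0 \<le> q" "q \<le> t" for p q
  proof -
    have "dist (x + p *\<^sub>R v + q *\<^sub>R w) x \<le> p * norm v + q * norm w"
      using that norm_triangle_ineq[of "p *\<^sub>R v" "q *\<^sub>R w"] by (simp add: dist_norm add.assoc)
    also have "\<dots> \<le> t * norm v + t * norm w" using that by (intro add_mono mult_right_mono) auto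
    also have "\<dots> < t * (norm v + norm w + 1)" using t by (simp add: algebra_simps)
    also have "\<dots> = d" using pos by (simp add: t_def)
    finally show ?thesis .
  qed
  obtain p q where 1: "0 < p" "p < t" "0 < q" "q < t"
    "f (x + t *\<^sub>R v + t *\<^sub>R w) - f (x + t *\<^sub>R v) - f (x + t *\<^sub>R w) + f x
       = t * t * ?P (x + p *\<^sub>R v + q *\<^sub>R w)"
    by (rule mixed_difference_mvt[OF sm t, of x v w]) (use near d3 in \<open>auto simp: d_def\<close>)
  obtain p' q' where 2: "0 < p'" "p' < t" "0 < q'" "q' < t"
    "f (x + t *\<^sub>R w + t *\<^sub>R v) - f (x + t *\<^sub>R w) - f (x + t *\<^sub>R v) + f x
       = t * t * ?Q (x + p' *\<^sub>R w + q' *\<^sub>R v)"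
  proof (rule mixed_difference_mvt[OF sm t, of x w v])
    show "x + p *\<^sub>R w + q *\<^sub>R v \<in> S" if "0 \<le> p" "p \<le> t" "0 \<le> q" "q \<le> t" for p q
      using near[of q p] d3(2) that by (auto simp: d_def algebra_simps)
  qed auto
  have "t * t * ?P (x + p *\<^sub>R v + q *\<^sub>R w) = t * t * ?Q (x + p' *\<^sub>R w + q' *\<^sub>R v)"
    using 1(5) 2(5) by (simp add: algebra_simps)
  then have "?P (x + p *\<^sub>R v + q *\<^sub>R w) = ?Q (x + q' *\<^sub>R v + p' *\<^sub>R w)"
    using t by (simp add: algebra_simps)
  moreover have "dist (?P (x + p *\<^sub>R v + q *\<^sub>R w)) (?P x) < e"
    using near[of p q] 1 by (intro d1(2)) (simp add: d_def)
  moreover have "dist (?Q (x + q' *\<^sub>R v + p' *\<^sub>R w)) (?Q x) < e"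
    using near[of q' p'] 2 by (intro d2(2)) (simp add: d_def)
  ultimately show False using e unfolding e_def by (simp add: dist_real_def abs_if split: if_splits)
qed

section \<open>Partial derivatives along the base and along the fibres\<close>

lemma fd_scaleR: "f differentiable at x \<Longrightarrow> fd f x (r *\<^sub>R v) = r *\<^sub>R fd f x v"
  by (simp add: linear_frechet_derivative linear_scale)

lemma fd_vec:
  fixes f :: "real^'n::finite \<Rightarrow> 'b::real_normed_vector"
  assumes "f differentiable at x"
  shows "fd f x v = (\<Sum>i\<in>UNIV. v $ i *\<^sub>R pd i f x)"
proof -
  have "fd f x v = fd f x (\<Sum>i\<in>UNIV. v $ i *\<^sub>R axis i 1)"
    by (simp add: scalar_mult_eq_scaleR[symmetric] basis_expansion)
  then show ?thesis
    using linear_frechet_derivative[OF assms] by (simp add: linear_sum linear_scale pd_def)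
qed

lemma fd_hpd_vpd:
  fixes f :: "(real^'n::finite) \<times> (real^'n) \<Rightarrow> real"
  assumes "f differentiable at z"
  shows "fd f z (v, w) = (\<Sum>i\<in>UNIV. v $ i * hpd i f z) + (\<Sum>i\<in>UNIV. w $ i * vpd i f z)"
proof -
  interpret linear "fd f z" by (rule linear_frechet_derivative[OF assms])
  have "(v, w) = (\<Sum>i\<in>UNIV. v $ i *\<^sub>R (axis i 1, 0)) + (\<Sum>i\<in>UNIV. w $ i *\<^sub>R (0, axis i 1))"
    by (simp add: sum_prod[symmetric] scalar_mult_eq_scaleR[symmetric] basis_expansion prod_eq_iff
       fst_sum snd_sum)
  then have "fd f z (v, w) =
      fd f z (\<Sum>i\<in>UNIV. v $ i *\<^sub>R (axis i 1, 0)) + fd f z (\<Sum>i\<in>UNIV. w $ i *\<^sub>R (0, axis i 1))"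
    by (metis add)
  then show ?thesis by (simp add: sum scale hpd_def vpd_def del: scaleR_Pair)
qed

lemma smooth_on_hpd: "smooth_on S f \<Longrightarrow> smooth_on S (hpd i f)"
  unfolding hpd_def by (rule smooth_on_fd)

lemma smooth_on_vpd: "smooth_on S f \<Longrightarrow> smooth_on S (vpd i f)"
  unfolding vpd_def by (rule smooth_on_fd)

lemma smooth_on_pd: "smooth_on S f \<Longrightarrow> smooth_on S (pd i f)"
  unfolding pd_def by (rule smooth_on_fd)

lemma hpd_vpd_commute:
  assumes "smooth_on S f" "open S" "z \<in> S"
  shows "hpd i (vpd j f) z = vpd j (hpd i f) z"
  using fd_fd_commute[OF assms] by (simp add: hpd_def[abs_def] vpd_def[abs_def])

lemma fibre_has_derivative:
  assumes "f differentiable at (x, y)"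
  shows "((\<lambda>y. f (x, y)) has_derivative (\<lambda>w. fd f (x, y) (0, w))) (at y)"
  by (rule has_derivative_compose[of "\<lambda>y. (x, y)"])
    (use assms in \<open>auto intro!: derivative_eq_intros simp flip: frechet_derivative_works\<close>)

lemma open_fibre: "open U \<Longrightarrow> open {y. (x, y) \<in> U}"
  using open_vimage[of U "\<lambda>y. (x, y)"] by (simp add: vimage_def continuous_on_Pair)

text \<open>A formula valid at one fixed \<open>x\<close> does not determine the full derivative of
  \<open>f\<close>, but derivatives along the fibre see only this slice.\<close>

lemma vpd_eqI:
  assumes "open U" "(x, y) \<in> U" "\<And>y. (x, y) \<in> U \<Longrightarrow> f (x, y) = g y" "f differentiable at (x, y)"
    and "(g has_derivative g') (at y)"
  shows "fd f (x, y) (0, w) = g' w" and "vpd k f (x, y) = g' (axis k 1)"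
proof -
  have "((\<lambda>y. f (x, y)) has_derivative g') (at y)"
    by (rule has_derivative_transform_within_open[OF assms(5) open_fibre[OF assms(1)]])
      (use assms in auto)
  then have "(\<lambda>w. fd f (x, y) (0, w)) = g'"
    using fibre_has_derivative[OF assms(4)] has_derivative_unique by blast
  then show "fd f (x, y) (0, w) = g' w" "vpd k f (x, y) = g' (axis k 1)"
    by (auto simp: vpd_def fun_eq_iff)
qed

text \<open>A linear form is its own derivative, and the derivative of a function that is zero on
  the open fibre is zero.\<close>

lemma linear_form_eq_0:
  fixes c :: "'n::finite \<Rightarrow> real"
  assumes "open U" "(x, y) \<in> U" "\<And>y. (x, y) \<in> U \<Longrightarrow> (\<Sum>l\<in>UNIV. c l * y $ l) = 0"
  shows "c k = 0"
proof -
  have "((\<lambda>y::real^'n. \<Sum>l\<in>UNIV. c l * y $ l) has_derivative (\<lambda>w. \<Sum>l\<in>UNIV. c l * w $ l)) (at y)"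
    by (auto intro!: derivative_eq_intros)
  then have "((\<lambda>y. 0) has_derivative (\<lambda>w::real^'n. \<Sum>l\<in>UNIV. c l * w $ l)) (at y)"
    by (rule has_derivative_transform_within_open[OF _ open_fibre[OF assms(1)]]) (use assms in auto)
  then have "(\<lambda>w::real^'n. \<Sum>l\<in>UNIV. c l * w $ l) = (\<lambda>w. 0)"
    using has_derivative_unique has_derivative_const by blast
  then have "(\<Sum>l\<in>UNIV. c l * axis k 1 $ l) = 0" by metis
  then show ?thesis by (simp add: axis_def if_distrib[of "\<lambda>x. _ * x"] cong: if_cong)
qed

section \<open>Affine connections annihilating a Lagrangian\<close>

text \<open>The pair of \<open>axis i 1\<close> and minus this vector is the horizontal lift
  \<open>\<delta>\<^sub>i\<close> of the i-th coordinate direction.\<close>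

definition conn :: "real^'n^'n^'n \<Rightarrow> 'n \<Rightarrow> real^'n::finite \<Rightarrow> real^'n" where
  "conn \<Gamma> i y = (\<chi> j. \<Sum>k\<in>UNIV. \<Gamma> $ j $ i $ k * y $ k)"

text \<open>This is \<open>\<delta>\<^sub>i L = 0\<close> for all \<open>i\<close>.\<close>

definition annihilates ::
    "((real^'n::finite) \<times> (real^'n) \<Rightarrow> real) \<Rightarrow> (real^'n \<Rightarrow> real^'n^'n^'n) \<Rightarrow> (real^'n) \<times> (real^'n) \<Rightarrow> bool" where
  "annihilates L \<Gamma> z \<longleftrightarrow> (\<forall>i. fd L z (axis i 1, - conn (\<Gamma> (fst z)) i (snd z)) = 0)"

text \<open>Four times the geodesic coefficients G, in the normalisation where geodesics satisfy x''
  + 2 G = 0.\<close>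

definition spray :: "((real^'n::finite) \<times> (real^'n) \<Rightarrow> real) \<Rightarrow> 'n \<Rightarrow> (real^'n) \<times> (real^'n) \<Rightarrow> real" where
  "spray L j z = (\<Sum>k\<in>UNIV. matrix_inv (fundamental_tensor L z) $ j $ k *
       ((\<Sum>m\<in>UNIV. snd z $ m * hpd m (vpd k L) z) - hpd k L z))"

lemma nonlinear_connection_spray: "nonlinear_connection L j i z = (1/4) * vpd i (spray L j) z"
  by (simp add: nonlinear_connection_def spray_def[abs_def])

lemma sum_axis [simp]:
  fixes f :: "'n::finite \<Rightarrow> real"
  shows "(\<Sum>i\<in>UNIV. f i * axis k 1 $ i) = f k" "(\<Sum>i\<in>UNIV. axis k 1 $ i * f i) = f k"
  by (simp_all add: axis_def if_distrib[of "\<lambda>x. _ * x"] if_distrib[of "\<lambda>x. x * _"] cong: if_cong)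

lemma annihilates_iff:
  assumes "L differentiable at (x, y)"
  shows "annihilates L \<Gamma> (x, y) \<longleftrightarrow>
    (\<forall>i. hpd i L (x, y) = (\<Sum>j\<in>UNIV. conn (\<Gamma> x) i y $ j * vpd j L (x, y)))"
  by (simp add: annihilates_def fd_hpd_vpd[OF assms] sum_negf)

lemma smooth_on_fundamental_tensor:
  "open U \<Longrightarrow> smooth_on U L \<Longrightarrow> smooth_on U (\<lambda>z. fundamental_tensor L z $ i $ j)"
  unfolding fundamental_tensor_def vec_lambda_beta by (intro smooth_on_mult smooth_on_const smooth_on_vpd)

lemma bounded_linear_snd_nth: "bounded_linear (\<lambda>z. snd z $ m)"
  by (rule bounded_linear_compose[OF bounded_linear_vec_nth bounded_linear_snd])

lemma smooth_on_spray:
  assumes "open U" "smooth_on U L" "\<And>z. z \<in> U \<Longrightarrow> invertible (fundamental_tensor L z)"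
  shows "smooth_on U (spray L j)"
  unfolding spray_def[abs_def]
  by (intro smooth_on_sum smooth_on_mult smooth_on_diff smooth_on_matrix_inv smooth_on_fundamental_tensor
      smooth_on_vpd smooth_on_hpd assms smooth_on_bounded_linear bounded_linear_snd_nth)

lemma smooth_on_nonlinear_connection:
  assumes "open U" "smooth_on U L" "\<And>z. z \<in> U \<Longrightarrow> invertible (fundamental_tensor L z)"
  shows "smooth_on U (nonlinear_connection L j i)"
  unfolding nonlinear_connection_spray[abs_def]
  by (intro smooth_on_mult smooth_on_const smooth_on_vpd smooth_on_spray assms)

lemma conn_scaleR: "conn \<Gamma> i (r *\<^sub>R y) = r *\<^sub>R conn \<Gamma> i y"
  by (simp add: conn_def vec_eq_iff algebra_simps sum_distrib_left)

lemma conn_has_derivative [derivative_intros]: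
  assumes "(f has_derivative f') (at u within S)"
  shows "((\<lambda>u. conn \<Gamma> i (f u) $ j) has_derivative (\<lambda>w. conn \<Gamma> i (f' w) $ j)) (at u within S)"
  unfolding conn_def by (auto intro!: derivative_eq_intros assms)

lemma conn_axis: "conn \<Gamma> i (axis k 1) $ j = \<Gamma> $ j $ i $ k"
  by (simp add: conn_def)

lemma contracted_conn_symmetric:
  assumes "\<And>j i k. \<Gamma> $ j $ i $ k = \<Gamma> $ j $ k $ i"
  shows "(\<Sum>m\<in>UNIV. y $ m * \<Gamma> $ j $ m $ k) = conn \<Gamma> k y $ j"
  using assms by (simp add: conn_def mult.commute)

text \<open>Differentiate \<open>\<delta>\<^sub>m L = 0\<close> along \<open>y\<^sup>k\<close> and
  contract with \<open>y\<^sup>m\<close>. By the symmetry of \<Gamma> the terms with first fibre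
  derivatives of \<open>L\<close> add up to \<open>hpd k L\<close> and cancel. What remains is the
  fundamental tensor applied to 2 q, where \<open>q\<^sup>j = \<Gamma>\<^sup>j\<^sub>m\<^sub>k
  y\<^sup>m y\<^sup>k\<close>. Hence the spray is 2 q, and a quarter of its fibre derivative is
  \<Gamma> y, again by symmetry.\<close>

lemma annihilates_imp_nonlinear_connection:
  fixes L :: "(real^'n::finite) \<times> (real^'n) \<Rightarrow> real"
  assumes U: "open U" and L: "smooth_on U L"
    and inv: "\<And>z. z \<in> U \<Longrightarrow> invertible (fundamental_tensor L z)"
    and sym: "\<And>x y j i k. (x, y) \<in> U \<Longrightarrow> \<Gamma> x $ j $ i $ k = \<Gamma> x $ j $ k $ i"
    and ann: "\<And>z. z \<in> U \<Longrightarrow> annihilates L \<Gamma> z"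
    and z: "(x, y) \<in> U"
  shows "nonlinear_connection L j i (x, y) = conn (\<Gamma> x) i y $ j"
proof -
  note dL = smooth_on_differentiable[OF L]
  have spray: "spray L j (x, y) = 2 * (\<Sum>m\<in>UNIV. y $ m * conn (\<Gamma> x) m y $ j)"
    if z: "(x, y) \<in> U" for x y j
  proof -
    let ?q = "\<lambda>j. \<Sum>m\<in>UNIV. y $ m * conn (\<Gamma> x) m y $ j"
    have H: "hpd m L (x, y) = (\<Sum>j\<in>UNIV. conn (\<Gamma> x) m y $ j * vpd j L (x, y))" if "(x, y) \<in> U" for m y
      using ann[OF that] annihilates_iff[OF dL[OF that]] by blast
    have VH: "hpd m (vpd k L) (x, y) =
        (\<Sum>j\<in>UNIV. \<Gamma> x $ j $ m $ k * vpd j L (x, y) + conn (\<Gamma> x) m y $ j * vpd k (vpd j L) (x, y))" for m k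
    proof -
      have "vpd k (hpd m L) (x, y) = (\<Sum>j\<in>UNIV. conn (\<Gamma> x) m y $ j * fd (vpd j L) (x, y) (0, axis k 1)
          + conn (\<Gamma> x) m (axis k 1) $ j * vpd j L (x, y))"
        by (rule vpd_eqI(2)[OF U z H smooth_on_differentiable[OF smooth_on_hpd[OF L] z]])
          (auto intro!: derivative_eq_intros fibre_has_derivative smooth_on_differentiable[OF smooth_on_vpd[OF L]] z)
      then show ?thesis
        by (simp add: hpd_vpd_commute[OF L U z] conn_axis vpd_def add.commute)
    qed
    have "(\<Sum>m\<in>UNIV. y $ m * hpd m (vpd k L) (x, y)) =
        (\<Sum>j\<in>UNIV. (\<Sum>m\<in>UNIV. y $ m * \<Gamma> x $ j $ m $ k) * vpd j L (x, y)) +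
        (\<Sum>j\<in>UNIV. ?q j * vpd k (vpd j L) (x, y))" for k
      unfolding VH sum_distrib_left sum_distrib_right
      by (subst sum.swap) (simp add: sum.distrib algebra_simps)
    then have "(\<Sum>m\<in>UNIV. y $ m * hpd m (vpd k L) (x, y)) - hpd k L (x, y) =
        (\<Sum>j\<in>UNIV. ?q j * vpd k (vpd j L) (x, y))" for k
      by (simp add: contracted_conn_symmetric[OF sym[OF z]] H[OF z])
    then have "(\<Sum>m\<in>UNIV. y $ m * hpd m (vpd k L) (x, y)) - hpd k L (x, y) =
        (fundamental_tensor L (x, y) *v (\<chi> j. 2 * ?q j)) $ k" for k
      by (simp add: fundamental_tensor_def matrix_vector_mult_def mult.commute)
    then have "spray L j (x, y) =
        (matrix_inv (fundamental_tensor L (x, y)) *v (fundamental_tensor L (x, y) *v (\<chi> j. 2 * ?q j))) $ j"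
      by (simp add: spray_def matrix_vector_mult_def[of "matrix_inv _"])
    then show ?thesis
      by (simp add: matrix_vector_mul_assoc matrix_inv_both inv z)
  qed
  have "vpd i (spray L j) (x, y) = 2 * (\<Sum>m\<in>UNIV. axis i 1 $ m * conn (\<Gamma> x) m y $ j
      + y $ m * conn (\<Gamma> x) m (axis i 1) $ j)"
    by (rule vpd_eqI(2)[OF U z spray smooth_on_differentiable[OF smooth_on_spray[OF U L inv] z]])
      (auto intro!: derivative_eq_intros simp: sum.distrib)
  then show ?thesis
    by (simp add: nonlinear_connection_spray sum.distrib conn_axis contracted_conn_symmetric[OF sym[OF z]])
qed

section \<open>Euler's theorem and homogeneous Lagrangians\<close>

lemma euler_homogeneous:
  assumes f: "(f has_derivative f') (at (y::'a::real_normed_vector))"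
    and hom: "\<And>r. r > 0 \<Longrightarrow> f (r *\<^sub>R y) = r ^ p * (f y :: real)"
  shows "f' y = p * f y"
proof -
  have 1: "((\<lambda>r. f (r *\<^sub>R y)) has_derivative (\<lambda>h. f' (h *\<^sub>R y))) (at 1)"
    by (rule has_derivative_compose[where f="\<lambda>r. r *\<^sub>R y" and g=f])
      (use f in \<open>auto intro!: derivative_eq_intros\<close>)
  have "((\<lambda>r. r ^ p * f y) has_derivative (\<lambda>h. f' (h *\<^sub>R y))) (at 1)"
    by (rule has_derivative_transform_within_open[OF 1, of "{0<..}"]) (use hom in auto)
  moreover have "((\<lambda>r. r ^ p * f y) has_derivative (\<lambda>h. h * (p * f y))) (at (1::real))"
    by (auto intro!: derivative_eq_intros)
  ultimately have "(\<lambda>h. f' (h *\<^sub>R y)) = (\<lambda>h. h * (p * f y))" by (rule has_derivative_unique)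
  then have "f' (1 *\<^sub>R y) = 1 * (p * f y)" by metis
  then show ?thesis by simp
qed

locale homogeneous_lagrangian =
  fixes U :: "((real^'n::finite) \<times> (real^'n)) set" and L :: "(real^'n) \<times> (real^'n) \<Rightarrow> real"
  assumes U: "open U" and L: "smooth_on U L"
    and cone: "\<And>x y r. (x, y) \<in> U \<Longrightarrow> r > 0 \<Longrightarrow> (x, r *\<^sub>R y) \<in> U"
    and hom: "\<And>x y r. (x, y) \<in> U \<Longrightarrow> r > 0 \<Longrightarrow> L (x, r *\<^sub>R y) = r ^ 2 * L (x, y)"
begin

text \<open>Scaling the fibre by \<open>r\<close> stretches fibre directions and leaves base
  directions alone. Hence base derivatives keep the degree of homogeneity and fibre derivatives
  lower it by one.\<close>

lemma fd_homogeneous: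
  assumes f: "smooth_on U f" and h: "\<And>x y. (x, y) \<in> U \<Longrightarrow> f (x, r *\<^sub>R y) = r ^ p * f (x, y)"
    and z: "(x, y) \<in> U" and r: "r > 0"
  shows "fd f (x, r *\<^sub>R y) (v, r *\<^sub>R w) = r ^ p * fd f (x, y) (v, w)"
proof -
  have "((\<lambda>z. f (fst z, r *\<^sub>R snd z)) has_derivative (\<lambda>u. fd f (x, r *\<^sub>R y) (fst u, r *\<^sub>R snd u))) (at (x, y))"
    by (rule has_derivative_compose[where f="\<lambda>z. (fst z, r *\<^sub>R snd z)" and g=f])
      (use smooth_on_has_derivative[OF f cone[OF z r]] in \<open>auto intro!: derivative_eq_intros\<close>)
  then have "((\<lambda>z. r ^ p * f z) has_derivative (\<lambda>u. fd f (x, r *\<^sub>R y) (fst u, r *\<^sub>R snd u))) (at (x, y))"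
    by (rule has_derivative_transform_within_open[OF _ U z]) (use h in auto)
  moreover have "((\<lambda>z. r ^ p * f z) has_derivative (\<lambda>u. r ^ p * fd f (x, y) u)) (at (x, y))"
    by (auto intro!: derivative_eq_intros smooth_on_has_derivative[OF f z])
  ultimately have "(\<lambda>u. fd f (x, r *\<^sub>R y) (fst u, r *\<^sub>R snd u)) = (\<lambda>u. r ^ p * fd f (x, y) u)"
    by (rule has_derivative_unique)
  from fun_cong[OF this, of "(v, w)"] show ?thesis by simp
qed

lemma hpd_homogeneous:
  assumes "smooth_on U f" "\<And>x y. (x, y) \<in> U \<Longrightarrow> f (x, r *\<^sub>R y) = r ^ p * f (x, y)" "(x, y) \<in> U" "r > 0"
  shows "hpd i f (x, r *\<^sub>R y) = r ^ p * hpd i f (x, y)"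
  using fd_homogeneous[of f r p x y "axis i 1" 0] assms by (simp add: hpd_def)

lemma vpd_homogeneous:
  assumes "smooth_on U f" "\<And>x y. (x, y) \<in> U \<Longrightarrow> f (x, r *\<^sub>R y) = r ^ Suc p * f (x, y)" "(x, y) \<in> U" "r > 0"
  shows "vpd i f (x, r *\<^sub>R y) = r ^ p * vpd i f (x, y)"
proof -
  have "fd f (x, r *\<^sub>R y) (0, r *\<^sub>R axis i 1) = r * vpd i f (x, r *\<^sub>R y)"
    using fd_scaleR[OF smooth_on_differentiable[OF assms(1) cone[OF assms(3,4)]], of r "(0, axis i 1)"]
    by (simp add: vpd_def)
  then show ?thesis
    using fd_homogeneous[of f r "Suc p" x y 0 "axis i 1"] assms by (simp add: vpd_def)
qed

lemma vpd_L_homogeneous: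
  "(x, y) \<in> U \<Longrightarrow> r > 0 \<Longrightarrow> vpd i L (x, r *\<^sub>R y) = r * vpd i L (x, y)"
  using vpd_homogeneous[of L r 1 x y i] L hom by (simp add: numeral_2_eq_2)

lemma hpd_L_homogeneous:
  "(x, y) \<in> U \<Longrightarrow> r > 0 \<Longrightarrow> hpd i L (x, r *\<^sub>R y) = r\<^sup>2 * hpd i L (x, y)"
  using hpd_homogeneous[of L r 2 x y i] L hom by simp

lemma spray_homogeneous:
  assumes z: "(x, y) \<in> U" and r: "r > 0"
  shows "spray L j (x, r *\<^sub>R y) = r\<^sup>2 * spray L j (x, y)"
proof -
  have "vpd i (vpd k L) (x, r *\<^sub>R y) = vpd i (vpd k L) (x, y)" for i k
    using vpd_homogeneous[of "vpd k L" r 0 x y i, OF smooth_on_vpd[OF L]] vpd_L_homogeneous r z by simp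
  then have "fundamental_tensor L (x, r *\<^sub>R y) = fundamental_tensor L (x, y)"
    by (simp add: fundamental_tensor_def)
  moreover have "hpd m (vpd k L) (x, r *\<^sub>R y) = r * hpd m (vpd k L) (x, y)" for m k
    using hpd_homogeneous[of "vpd k L" r 1 x y m, OF smooth_on_vpd[OF L]] vpd_L_homogeneous r z by simp
  ultimately show ?thesis
    by (simp add: spray_def hpd_L_homogeneous[OF z r] sum_distrib_left sum_distrib_right algebra_simps power2_eq_square
        sum_subtractf)
qed

text \<open>Put \<open>E\<^sub>m = \<delta>\<^sub>m L\<close> and \<open>h = y\<^sup>m E\<^sub>m\<close>, which is homogeneous of degree 3. The equation for the spray
  says \<open>y\<^sup>m \<partial>\<^sub>y\<^sub>k E\<^sub>m = E\<^sub>k\<close>, whence \<open>\<partial>\<^sub>y\<^sub>k h = 2 E\<^sub>k\<close>. Contracting with \<open>y\<^sup>k\<close>, Euler's theorem gives \<open>3 h = 2 h\<close>,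
  so \<open>h\<close> and hence \<open>E\<close> vanish.\<close>

lemma nonlinear_connection_imp_annihilates:
  assumes inv: "\<And>z. z \<in> U \<Longrightarrow> invertible (fundamental_tensor L z)"
    and N: "\<And>x y j i. (x, y) \<in> U \<Longrightarrow> nonlinear_connection L j i (x, y) = conn (\<Gamma> x) i y $ j"
    and z: "(x, y) \<in> U"
  shows "\<Gamma> x $ j $ i $ k = \<Gamma> x $ j $ k $ i" and "annihilates L \<Gamma> (x, y)"
proof -
  note S = smooth_on_spray[OF U L inv]
  \<comment> \<open>Euler's theorem in degree 2, with N inserted for the fibre derivatives, says
    that twice the spray is \<open>4 y\<^sup>m N\<^sup>j\<^sub>m\<close>.\<close>
  have spray: "spray L j (x, y) = 2 * (\<Sum>m\<in>UNIV. y $ m * conn (\<Gamma> x) m y $ j)" if z: "(x, y) \<in> U" for y j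
  proof -
    have "fd (spray L j) (x, y) (0, y) = 2 * spray L j (x, y)"
      using euler_homogeneous[OF fibre_has_derivative[OF smooth_on_differentiable[OF S z]], where p=2]
        spray_homogeneous[OF z] by simp
    moreover have "fd (spray L j) (x, y) (0, y) = 4 * (\<Sum>m\<in>UNIV. y $ m * conn (\<Gamma> x) m y $ j)"
      using fd_hpd_vpd[OF smooth_on_differentiable[OF S z], where v=0 and w=y] N[OF z]
      by (simp add: nonlinear_connection_spray sum_distrib_left mult_ac)
    ultimately show ?thesis by simp
  qed
  \<comment> \<open>Differentiating the quadratic form gives the symmetrised \<Gamma>, whereas N is
    given by \<Gamma> itself. So the antisymmetric part annihilates every \<open>y\<close> in the
    open fibre.\<close>
  have sym: "\<Gamma> x $ j $ i $ k = \<Gamma> x $ j $ k $ i" for j i k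
  proof -
    have "(\<Sum>l\<in>UNIV. (\<Gamma> x $ j $ i $ l - \<Gamma> x $ j $ l $ i) * y $ l) = 0" if z: "(x, y) \<in> U" for y
    proof -
      have "vpd i (spray L j) (x, y) = 2 * (\<Sum>m\<in>UNIV. axis i 1 $ m * conn (\<Gamma> x) m y $ j
          + y $ m * conn (\<Gamma> x) m (axis i 1) $ j)"
        by (rule vpd_eqI(2)[OF U z spray smooth_on_differentiable[OF S z]])
          (auto intro!: derivative_eq_intros simp: sum.distrib)
      then have "conn (\<Gamma> x) i y $ j = (\<Sum>m\<in>UNIV. y $ m * \<Gamma> x $ j $ m $ i)"
        using N[OF z, of j i] by (simp add: nonlinear_connection_spray sum.distrib conn_axis)
      then show ?thesis by (simp add: conn_def algebra_simps sum_subtractf)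
    qed
    from linear_form_eq_0[OF U z this, where k=k] show ?thesis by simp
  qed
  then show "\<Gamma> x $ j $ i $ k = \<Gamma> x $ j $ k $ i" .
  define E where "E m y = hpd m L (x, y) - (\<Sum>j\<in>UNIV. conn (\<Gamma> x) m y $ j * vpd j L (x, y))" for m y
  define h where "h y = (\<Sum>m\<in>UNIV. y $ m * E m y)" for y
  define E' where "E' m y w = fd (hpd m L) (x, y) (0, w) -
      (\<Sum>j\<in>UNIV. conn (\<Gamma> x) m y $ j * fd (vpd j L) (x, y) (0, w) + conn (\<Gamma> x) m w $ j * vpd j L (x, y))" for m y w
  have dE: "(E m has_derivative E' m y) (at y)" if z: "(x, y) \<in> U" for m y
    unfolding E_def E'_def
    by (auto intro!: derivative_eq_intros fibre_has_derivative
        smooth_on_differentiable[OF smooth_on_vpd[OF L]] smooth_on_differentiable[OF smooth_on_hpd[OF L]] z)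
  \<comment> \<open>Multiplying the spray formula by the fundamental tensor removes its inverse;
    once the symmetry of \<Gamma> is used, the terms left over are those of
    \<open>E k\<close>.\<close>
  have E'_eq: "(\<Sum>m\<in>UNIV. y $ m * E' m y (axis k 1)) = E k y" if z: "(x, y) \<in> U" for y k
  proof -
    let ?q = "\<lambda>j. \<Sum>m\<in>UNIV. y $ m * conn (\<Gamma> x) m y $ j"
    let ?g = "fundamental_tensor L (x, y)"
    let ?e = "\<chi> k. (\<Sum>m\<in>UNIV. y $ m * hpd m (vpd k L) (x, y)) - hpd k L (x, y)"
    have "(\<chi> j. 2 * ?q j) = matrix_inv ?g *v ?e"
      using spray[OF z] by (simp add: vec_eq_iff spray_def matrix_vector_mult_def)
    then have "?g *v (\<chi> j. 2 * ?q j) = ?e"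
      by (simp add: matrix_vector_mul_assoc matrix_inv_both inv z)
    then have "(\<Sum>m\<in>UNIV. y $ m * hpd m (vpd k L) (x, y)) - hpd k L (x, y) =
        (\<Sum>j\<in>UNIV. ?q j * vpd k (vpd j L) (x, y))"
      by (simp add: vec_eq_iff matrix_vector_mult_def fundamental_tensor_def mult.commute)
    moreover have "(\<Sum>m\<in>UNIV. y $ m * E' m y (axis k 1)) =
        (\<Sum>m\<in>UNIV. y $ m * hpd m (vpd k L) (x, y)) - (\<Sum>j\<in>UNIV. ?q j * vpd k (vpd j L) (x, y))
        - (\<Sum>j\<in>UNIV. (\<Sum>m\<in>UNIV. y $ m * \<Gamma> x $ j $ m $ k) * vpd j L (x, y))"
    proof -
      have "E' m y (axis k 1) = hpd m (vpd k L) (x, y) -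
          (\<Sum>j\<in>UNIV. conn (\<Gamma> x) m y $ j * vpd k (vpd j L) (x, y) + \<Gamma> x $ j $ m $ k * vpd j L (x, y))" for m
        by (simp add: E'_def conn_axis hpd_vpd_commute[OF L U z] flip: vpd_def)
      moreover have "(\<Sum>m\<in>UNIV. y $ m *
          (\<Sum>j\<in>UNIV. conn (\<Gamma> x) m y $ j * vpd k (vpd j L) (x, y) + \<Gamma> x $ j $ m $ k * vpd j L (x, y))) =
          (\<Sum>j\<in>UNIV. ?q j * vpd k (vpd j L) (x, y))
        + (\<Sum>j\<in>UNIV. (\<Sum>m\<in>UNIV. y $ m * \<Gamma> x $ j $ m $ k) * vpd j L (x, y))"
        unfolding sum_distrib_left sum_distrib_right
        by (subst sum.swap) (simp add: sum.distrib algebra_simps)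
      ultimately show ?thesis by (simp add: right_diff_distrib sum_subtractf)
    qed
    ultimately show ?thesis by (simp add: contracted_conn_symmetric[OF sym] E_def)
  qed
  have dh: "(h has_derivative (\<lambda>w. \<Sum>m\<in>UNIV. y $ m * E' m y w + w $ m * E m y)) (at y)"
    if "(x, y) \<in> U" for y
    unfolding h_def by (auto intro!: derivative_eq_intros dE that)
  have dh_axis: "(\<Sum>m\<in>UNIV. y $ m * E' m y (axis k 1) + axis k 1 $ m * E m y) = 2 * E k y"
    if "(x, y) \<in> U" for y k
    using E'_eq[OF that] by (simp add: sum.distrib)
  have h0: "h y = 0" if z: "(x, y) \<in> U" for y
  proof -
    have "h (r *\<^sub>R y) = r ^ 3 * h y" if r: "r > 0" for r
      by (simp add: h_def E_def hpd_L_homogeneous[OF z r] vpd_L_homogeneous[OF z r] conn_scaleR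
          sum_distrib_left right_diff_distrib sum_subtractf algebra_simps power2_eq_square power3_eq_cube)
    from euler_homogeneous[OF dh[OF z] this]
    have "(\<Sum>m\<in>UNIV. y $ m * E' m y y + y $ m * E m y) = 3 * h y" by simp
    moreover have "(\<Sum>m\<in>UNIV. y $ m * E' m y y) = h y"
    proof -
      have "E' m y y = (\<Sum>k\<in>UNIV. y $ k * E' m y (axis k 1))" for m
      proof -
        interpret linear "E' m y" using dE[OF z] by (rule has_derivative_linear)
        have "E' m y y = E' m y (\<Sum>k\<in>UNIV. y $ k *\<^sub>R axis k 1)"
          by (simp add: scalar_mult_eq_scaleR[symmetric] basis_expansion)
        then show ?thesis by (simp add: sum scale)
      qed
      then have "(\<Sum>m\<in>UNIV. y $ m * E' m y y) = (\<Sum>m\<in>UNIV. \<Sum>k\<in>UNIV. y $ k * (y $ m * E' m y (axis k 1)))"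
        by (simp add: sum_distrib_left algebra_simps)
      also have "\<dots> = (\<Sum>k\<in>UNIV. y $ k * (\<Sum>m\<in>UNIV. y $ m * E' m y (axis k 1)))"
        unfolding sum_distrib_left by (rule sum.swap)
      finally show ?thesis by (simp add: E'_eq[OF z] h_def)
    qed
    ultimately show ?thesis by (simp add: sum.distrib h_def)
  qed
  have "E k y = 0" for k
  proof -
    have "((\<lambda>y. 0) has_derivative (\<lambda>w. \<Sum>m\<in>UNIV. y $ m * E' m y w + w $ m * E m y)) (at y)"
      by (rule has_derivative_transform_within_open[OF dh[OF z] open_fibre[OF U]]) (use z h0 in auto)
    then have "(\<lambda>w. \<Sum>m\<in>UNIV. y $ m * E' m y w + w $ m * E m y) = (\<lambda>w. 0)"
      using has_derivative_unique has_derivative_const by blast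
    from fun_cong[OF this, of "axis k 1"] show ?thesis using dh_axis[OF z] by simp
  qed
  then show "annihilates L \<Gamma> (x, y)"
    using annihilates_iff[OF smooth_on_differentiable[OF L z]] by (simp add: E_def)
qed

end

text \<open>At a zero of \<open>f\<close> the fibre derivative of the square \<open>L\<close>
  vanishes. By Euler's theorem in degree 1 that derivative is
  \<open>2 g\<^sub>i\<^sub>j y\<^sup>i\<close>, so \<open>y\<close> would be a nonzero vector in the
  kernel of g.\<close>

lemma (in homogeneous_lagrangian) square_root_nonzero:
  assumes f: "smooth_on U f" and sq: "\<And>z. z \<in> U \<Longrightarrow> L z = (f z)\<^sup>2"
    and inv: "\<And>z. z \<in> U \<Longrightarrow> invertible (fundamental_tensor L z)"
    and z: "(x, y) \<in> U" and y: "y \<noteq> 0"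
  shows "f (x, y) \<noteq> 0"
proof
  assume f0: "f (x, y) = 0"
  let ?g = "fundamental_tensor L (x, y)"
  have "((\<lambda>z. (f z)\<^sup>2) has_derivative (\<lambda>u. 2 * f (x, y) * fd f (x, y) u)) (at (x, y))"
    by (rule has_derivative_eq_rhs[OF has_derivative_power[OF smooth_on_has_derivative[OF f z], where n=2]])
      (simp add: fun_eq_iff)
  then have "(L has_derivative (\<lambda>u. 2 * f (x, y) * fd f (x, y) u)) (at (x, y))"
    by (rule has_derivative_transform_within_open[OF _ U z]) (simp add: sq)
  then have v0: "vpd j L (x, y) = 0" for j
    by (simp add: vpd_def fd_eqI f0)
  have "(\<Sum>i\<in>UNIV. y $ i * vpd i (vpd j L) (x, y)) = 0" for j
  proof -
    note d = smooth_on_differentiable[OF smooth_on_vpd[OF L, of j] z]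
    have "fd (vpd j L) (x, y) (0, y) = 1 * vpd j L (x, y)"
      using euler_homogeneous[OF fibre_has_derivative[OF d], where p=1] vpd_L_homogeneous[OF z] by simp
    then show ?thesis using fd_hpd_vpd[OF d, where v=0 and w=y] v0 by simp
  qed
  then have "y v* ?g = 0"
    by (simp add: vec_eq_iff vector_matrix_mult_def fundamental_tensor_def sum_divide_distrib[symmetric] mult.commute)
  then have "y v* (?g ** matrix_inv ?g) = 0"
    by (simp add: vector_matrix_mul_assoc[symmetric])
  then show False using y by (simp add: matrix_inv_both inv z)
qed

section \<open>Uniqueness and smoothness of the connection coefficients\<close>

lemma fd_vec_nth:
  assumes "f differentiable at x"
  shows "fd (\<lambda>x. f x $ k) x v = fd f x v $ k"
proof -
  have "((\<lambda>x. f x $ k) has_derivative (\<lambda>v. fd f x v $ k)) (at x)"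
    by (intro has_derivative_vec_nth) (use assms frechet_derivative_works in blast)
  from fun_cong[OF fd_eqI[OF this]] show ?thesis .
qed

lemma pd_vec_nth: "f differentiable at x \<Longrightarrow> pd i (\<lambda>x. f x $ k) x = pd i f x $ k"
  by (simp add: pd_def fd_vec_nth)

lemma pd_cong:
  "open S \<Longrightarrow> x \<in> S \<Longrightarrow> (\<And>x. x \<in> S \<Longrightarrow> f x = g x) \<Longrightarrow> pd i f x = pd i g x"
  unfolding pd_def using fd_cong by metis

lemma connection_unique:
  fixes \<Gamma> \<Gamma>' :: "real^'n^'n^'n::finite"
  assumes "open U" "(x, y) \<in> U" "\<And>y. (x, y) \<in> U \<Longrightarrow> conn \<Gamma> i y $ j = conn \<Gamma>' i y $ j"
  shows "\<Gamma> $ j $ i $ k = \<Gamma>' $ j $ i $ k"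
proof -
  have "(\<Sum>l\<in>UNIV. (\<Gamma> $ j $ i $ l - \<Gamma>' $ j $ i $ l) * y $ l) = 0" if "(x, y) \<in> U" for y
    using assms(3)[OF that] by (simp add: conn_def algebra_simps sum_subtractf)
  from linear_form_eq_0[OF assms(1,2) this, where k=k] show ?thesis by simp
qed

text \<open>\<open>\<Gamma>\<^sup>j\<^sub>i\<^sub>k(x)\<close> is \<open>\<partial>\<^sub>y\<^sub>k N\<^sup>j\<^sub>i(x, y\<^sub>0)\<close> with \<open>y\<^sub>0\<close> locally constant.\<close>

lemma smooth_on_connection:
  fixes L :: "(real^'n::finite) \<times> (real^'n) \<Rightarrow> real"
  assumes U: "open U" and L: "smooth_on U L"
    and inv: "\<And>z. z \<in> U \<Longrightarrow> invertible (fundamental_tensor L z)"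
    and N: "\<And>x y j i. (x, y) \<in> U \<Longrightarrow> nonlinear_connection L j i (x, y) = conn (\<Gamma> x) i y $ j"
    and fibre: "\<And>x. x \<in> W \<Longrightarrow> \<exists>y. (x, y) \<in> U"
  shows "smooth_on W \<Gamma>"
proof (rule smooth_on_local)
  fix x0 assume "x0 \<in> W"
  then obtain y0 where z0: "(x0, y0) \<in> U" using fibre by blast
  let ?V = "{x. (x, y0) \<in> U}"
  have V: "open ?V"
    using open_vimage[OF U, of "\<lambda>x. (x, y0)"] by (simp add: vimage_def continuous_on_Pair)
  note sN = smooth_on_nonlinear_connection[OF U L inv]
  have eq: "(\<chi> j i k. vpd k (nonlinear_connection L j i) (x, y0)) = \<Gamma> x" if x: "x \<in> ?V" for x
  proof -
    have "vpd k (nonlinear_connection L j i) (x, y0) = conn (\<Gamma> x) i (axis k 1) $ j" for k j i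
      by (rule vpd_eqI(2)[OF U _ N smooth_on_differentiable[OF sN]])
        (use x in \<open>auto intro!: derivative_eq_intros\<close>)
    then show ?thesis by (simp add: vec_eq_iff conn_axis)
  qed
  have "smooth_on ?V (\<lambda>x. \<chi> j i k. vpd k (nonlinear_connection L j i) (x, y0))"
    by (intro smooth_on_vec_lambda V smooth_on_compose[OF V U smooth_on_vpd[OF sN]]
        smooth_on_Pair[OF V] smooth_on_const smooth_on_bounded_linear bounded_linear_ident) auto
  then have "smooth_on ?V \<Gamma>" by (rule smooth_on_cong[OF V eq, rotated])
  then show "\<exists>V. open V \<and> x0 \<in> V \<and> smooth_on V \<Gamma>" using V z0 by blast
qed

section \<open>Change of coordinates\<close>

text \<open>The law in \<open>torsion_free_affine_connection\<close> for a single coordinate change,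
  written with derivatives of the vector-valued map \<psi>. The two coefficient arrays are the
  values at \<open>x\<close> and at its image.\<close>

definition connection_law ::
    "(real^'n \<Rightarrow> real^'n) \<Rightarrow> real^'n^'n^'n \<Rightarrow> real^'n^'n^'n \<Rightarrow> real^'n::finite \<Rightarrow> bool" where
  "connection_law \<psi> \<Gamma> \<Gamma>' x \<longleftrightarrow> (\<forall>m i k. (\<Sum>j\<in>UNIV. pd j \<psi> x $ m * \<Gamma> $ j $ i $ k) =
     pd i (pd k \<psi>) x $ m + (\<Sum>p\<in>UNIV. \<Sum>q\<in>UNIV. pd i \<psi> x $ p * pd k \<psi> x $ q * \<Gamma>' $ m $ p $ q))"

text \<open>\<open>L\<close> is the pullback of \<open>L'\<close> along the tangent map of \<psi>.
  The sets \<open>U\<close> and \<open>U'\<close> stay general because two cases are needed: the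
  cone of F in two charts, and the full tangent spaces for the Levi-Civita connection.\<close>

locale tangent_map =
  fixes W :: "(real^'n::finite) set" and \<psi> :: "real^'n \<Rightarrow> real^'n"
    and U U' :: "((real^'n) \<times> (real^'n)) set" and L L' :: "(real^'n) \<times> (real^'n) \<Rightarrow> real"
  assumes W: "open W" and \<psi>: "smooth_on W \<psi>"
    and U: "open U" "open U'" and L: "smooth_on U L" "smooth_on U' L'"
    and base: "\<And>x y. (x, y) \<in> U \<Longrightarrow> x \<in> W"
    and maps: "\<And>x y. (x, y) \<in> U \<Longrightarrow> (\<psi> x, fd \<psi> x y) \<in> U'"
    and pull: "\<And>x y. (x, y) \<in> U \<Longrightarrow> L (x, y) = L' (\<psi> x, fd \<psi> x y)"
begin

lemma fd_\<psi>: "x \<in> W \<Longrightarrow> fd \<psi> x y = (\<Sum>k\<in>UNIV. y $ k *\<^sub>R pd k \<psi> x)"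
  by (rule fd_vec[OF smooth_on_differentiable[OF \<psi>]])

text \<open>Second derivatives of \<psi> appear because the fibre component
  \<open>y\<^sup>k \<partial>\<^sub>k \<psi>(x)\<close> of the tangent map also depends on the base
  point.\<close>

lemma fd_pullback:
  assumes z: "(x, y) \<in> U"
  shows "fd L (x, y) (v, w) = fd L' (\<psi> x, fd \<psi> x y)
    (fd \<psi> x v, \<Sum>k\<in>UNIV. y $ k *\<^sub>R fd (pd k \<psi>) x v + w $ k *\<^sub>R pd k \<psi> x)"
proof -
  note x = base[OF z]
  have d\<psi>: "((\<lambda>z. \<psi> (fst z)) has_derivative (\<lambda>u. fd \<psi> x (fst u))) (at (x, y))"
    by (rule has_derivative_compose[where f=fst and g=\<psi>])
      (use smooth_on_has_derivative[OF \<psi> x] in \<open>auto intro!: derivative_eq_intros\<close>)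
  have d2: "((\<lambda>z. pd k \<psi> (fst z)) has_derivative (\<lambda>u. fd (pd k \<psi>) x (fst u))) (at (x, y))" for k
    by (rule has_derivative_compose[where f=fst and g="pd k \<psi>"])
      (use smooth_on_has_derivative[OF smooth_on_pd[OF \<psi>] x] in \<open>auto intro!: derivative_eq_intros\<close>)
  have "((\<lambda>z. (\<psi> (fst z), \<Sum>k\<in>UNIV. snd z $ k *\<^sub>R pd k \<psi> (fst z))) has_derivative
      (\<lambda>u. (fd \<psi> x (fst u), \<Sum>k\<in>UNIV. y $ k *\<^sub>R fd (pd k \<psi>) x (fst u) + snd u $ k *\<^sub>R pd k \<psi> x))) (at (x, y))"
    by (auto intro!: derivative_eq_intros d\<psi> d2)
  then have "((\<lambda>z. L' (\<psi> (fst z), \<Sum>k\<in>UNIV. snd z $ k *\<^sub>R pd k \<psi> (fst z))) has_derivative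
      (\<lambda>u. fd L' (\<psi> x, fd \<psi> x y) (fd \<psi> x (fst u),
        \<Sum>k\<in>UNIV. y $ k *\<^sub>R fd (pd k \<psi>) x (fst u) + snd u $ k *\<^sub>R pd k \<psi> x))) (at (x, y))"
    by (rule has_derivative_compose[where g=L'])
      (use smooth_on_has_derivative[OF L(2) maps[OF z]] in \<open>simp add: fd_\<psi>[OF x]\<close>)
  then have "(L has_derivative
      (\<lambda>u. fd L' (\<psi> x, fd \<psi> x y) (fd \<psi> x (fst u),
        \<Sum>k\<in>UNIV. y $ k *\<^sub>R fd (pd k \<psi>) x (fst u) + snd u $ k *\<^sub>R pd k \<psi> x))) (at (x, y))"
    by (rule has_derivative_transform_within_open[OF _ U(1) z]) (auto simp: pull fd_\<psi>[OF base])
  from fun_cong[OF fd_eqI[OF this], of "(v, w)"] show ?thesis by simp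
qed

text \<open>The transformation law makes the tangent map carry \<open>\<delta>\<^sub>i\<close> to
  the combination of the lifts \<open>\<delta>'\<^sub>p\<close> with coefficients
  \<open>\<partial>\<^sub>i \<psi>\<^sup>p\<close>, and each of these lifts annihilates
  \<open>L'\<close>.\<close>

lemma annihilates_pullback:
  assumes ann: "annihilates L' \<Gamma>' (\<psi> x, fd \<psi> x y)" and z: "(x, y) \<in> U"
    and law: "connection_law \<psi> (\<Gamma> x) (\<Gamma>' (\<psi> x)) x"
  shows "annihilates L \<Gamma> (x, y)"
  unfolding annihilates_def
proof (intro allI, unfold fst_conv snd_conv)
  fix i
  note x = base[OF z]
  let ?y = "fd \<psi> x y"
  interpret linear "fd L' (\<psi> x, ?y)"
    by (rule linear_frechet_derivative[OF smooth_on_differentiable[OF L(2) maps[OF z]]])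
  \<comment> \<open>This is the law contracted with \<open>y\<^sup>k\<close>: its second-derivative
    term cancels the one coming from the tangent map.\<close>
  have vert: "(\<Sum>k\<in>UNIV. y $ k *\<^sub>R fd (pd k \<psi>) x (axis i 1) + (- conn (\<Gamma> x) i y) $ k *\<^sub>R pd k \<psi> x)
      = (\<Sum>p\<in>UNIV. pd i \<psi> x $ p *\<^sub>R - conn (\<Gamma>' (\<psi> x)) p ?y)" (is "?l = ?r")
  proof (simp only: vec_eq_iff, intro allI)
    fix m
    have "(\<Sum>j\<in>UNIV. conn (\<Gamma> x) i y $ j * pd j \<psi> x $ m) =
        (\<Sum>k\<in>UNIV. y $ k * (\<Sum>j\<in>UNIV. pd j \<psi> x $ m * \<Gamma> x $ j $ i $ k))"
      unfolding conn_def vec_lambda_beta sum_distrib_right sum_distrib_left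
      by (subst sum.swap) (simp add: mult_ac)
    also have "\<dots> = (\<Sum>k\<in>UNIV. y $ k * pd i (pd k \<psi>) x $ m) +
        (\<Sum>k\<in>UNIV. \<Sum>p\<in>UNIV. \<Sum>q\<in>UNIV. y $ k * (pd i \<psi> x $ p * pd k \<psi> x $ q * \<Gamma>' (\<psi> x) $ m $ p $ q))"
      using law by (simp add: connection_law_def distrib_left sum.distrib sum_distrib_left)
    also have "(\<Sum>k\<in>UNIV. \<Sum>p\<in>UNIV. \<Sum>q\<in>UNIV. y $ k * (pd i \<psi> x $ p * pd k \<psi> x $ q * \<Gamma>' (\<psi> x) $ m $ p $ q)) =
        (\<Sum>p\<in>UNIV. pd i \<psi> x $ p * conn (\<Gamma>' (\<psi> x)) p ?y $ m)"
    proof -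
      have "(\<Sum>p\<in>UNIV. pd i \<psi> x $ p * conn (\<Gamma>' (\<psi> x)) p ?y $ m) =
          (\<Sum>p\<in>UNIV. \<Sum>q\<in>UNIV. \<Sum>k\<in>UNIV. y $ k * (pd i \<psi> x $ p * pd k \<psi> x $ q * \<Gamma>' (\<psi> x) $ m $ p $ q))"
        by (simp add: conn_def fd_\<psi>[OF x] sum_distrib_left mult_ac)
      also have "\<dots> = (\<Sum>p\<in>UNIV. \<Sum>k\<in>UNIV. \<Sum>q\<in>UNIV. y $ k * (pd i \<psi> x $ p * pd k \<psi> x $ q * \<Gamma>' (\<psi> x) $ m $ p $ q))"
        by (intro sum.cong refl sum.swap)
      also have "\<dots> = (\<Sum>k\<in>UNIV. \<Sum>p\<in>UNIV. \<Sum>q\<in>UNIV. y $ k * (pd i \<psi> x $ p * pd k \<psi> x $ q * \<Gamma>' (\<psi> x) $ m $ p $ q))"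
        by (rule sum.swap)
      finally show ?thesis by simp
    qed
    finally show "?l $ m = ?r $ m"
      by (simp add: sum.distrib sum_negf sum_subtractf pd_def[of i "pd _ \<psi>"])
  qed
  have "(fd \<psi> x (axis i 1), ?r) = (\<Sum>p\<in>UNIV. pd i \<psi> x $ p *\<^sub>R (axis p 1, - conn (\<Gamma>' (\<psi> x)) p ?y))"
    by (simp add: prod_eq_iff fst_sum snd_sum scalar_mult_eq_scaleR[symmetric] basis_expansion flip: pd_def)
  then have "fd L (x, y) (axis i 1, - conn (\<Gamma> x) i y) =
      (\<Sum>p\<in>UNIV. pd i \<psi> x $ p * fd L' (\<psi> x, ?y) (axis p 1, - conn (\<Gamma>' (\<psi> x)) p ?y))"
    unfolding fd_pullback[OF z] vert by (simp add: sum scale del: scaleR_Pair)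
  then show "fd L (x, y) (axis i 1, - conn (\<Gamma> x) i y) = 0"
    using ann by (simp add: annihilates_def)
qed

text \<open>The coefficients \<open>G\<close> obtained from \<open>\<Gamma>'\<close> by the transformation law also annihilate \<open>L\<close>, so both \<open>G\<close>
  and \<open>\<Gamma>\<close> give the nonlinear connection of \<open>L\<close> and must agree.\<close>

lemma connection_transforms:
  assumes inv: "\<And>z. z \<in> U \<Longrightarrow> invertible (fundamental_tensor L z)"
    and sym: "\<And>x y j i k. (x, y) \<in> U \<Longrightarrow> \<Gamma> x $ j $ i $ k = \<Gamma> x $ j $ k $ i"
    and ann: "\<And>z. z \<in> U \<Longrightarrow> annihilates L \<Gamma> z"
    and sym': "\<And>x y j i k. (x, y) \<in> U' \<Longrightarrow> \<Gamma>' x $ j $ i $ k = \<Gamma>' x $ j $ k $ i"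
    and ann': "\<And>z. z \<in> U' \<Longrightarrow> annihilates L' \<Gamma>' z"
    and jac: "\<And>x. x \<in> W \<Longrightarrow> invertible (\<chi> m j. pd j \<psi> x $ m)"
    and z: "(x, y) \<in> U"
  shows "connection_law \<psi> (\<Gamma> x) (\<Gamma>' (\<psi> x)) x"
proof -
  \<comment> \<open>\<open>R\<close> is the right side of the transformation law; \<open>G\<close>
    solves the law by means of the inverse Jacobian.\<close>
  define R where "R x i k = (\<chi> m. pd i (pd k \<psi>) x $ m +
    (\<Sum>p\<in>UNIV. \<Sum>q\<in>UNIV. pd i \<psi> x $ p * pd k \<psi> x $ q * \<Gamma>' (\<psi> x) $ m $ p $ q))" for x i k
  define G where "G x = (\<chi> j i k. (matrix_inv (\<chi> m j. pd j \<psi> x $ m) *v R x i k) $ j)" for x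
  have law: "connection_law \<psi> (G x) (\<Gamma>' (\<psi> x)) x" if x: "x \<in> W" for x
    unfolding connection_law_def
  proof (intro allI)
    fix m i k
    have "(\<Sum>j\<in>UNIV. pd j \<psi> x $ m * G x $ j $ i $ k) =
        ((\<chi> m j. pd j \<psi> x $ m) *v (matrix_inv (\<chi> m j. pd j \<psi> x $ m) *v R x i k)) $ m"
      by (simp add: G_def matrix_vector_mult_def[of "\<chi> m j. pd j \<psi> x $ m"])
    then show "(\<Sum>j\<in>UNIV. pd j \<psi> x $ m * G x $ j $ i $ k) =
     pd i (pd k \<psi>) x $ m + (\<Sum>p\<in>UNIV. \<Sum>q\<in>UNIV. pd i \<psi> x $ p * pd k \<psi> x $ q * \<Gamma>' (\<psi> x) $ m $ p $ q)"
      by (simp add: matrix_vector_mul_assoc matrix_inv_both jac x) (simp add: R_def)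
  qed
  \<comment> \<open>Commuting second derivatives of \<psi> and the symmetry of \<Gamma>' make
    \<open>R\<close>, and with it \<open>G\<close>, symmetric, as the comparison with the nonlinear
    connection requires.\<close>
  have "R x i k = R x k i" if "(x, y) \<in> U" for x y i k
  proof -
    note x = base[OF that]
    have "pd i (pd k \<psi>) x $ m = pd k (pd i \<psi>) x $ m" for m
    proof -
      have "pd i (pd k \<psi>) x $ m = pd i (pd k (\<lambda>x. \<psi> x $ m)) x" for i k
        by (subst pd_vec_nth[OF smooth_on_differentiable[OF smooth_on_pd[OF \<psi>] x], symmetric])
          (rule pd_cong[OF W x], simp add: pd_vec_nth smooth_on_differentiable[OF \<psi>])
      moreover have "pd i (pd k (\<lambda>x. \<psi> x $ m)) x = pd k (pd i (\<lambda>x. \<psi> x $ m)) x"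
        using fd_fd_commute[OF smooth_on_vec_nth[OF W \<psi>] W x] by (simp add: pd_def[abs_def])
      ultimately show ?thesis by simp
    qed
    moreover have "(\<Sum>p\<in>UNIV. \<Sum>q\<in>UNIV. pd i \<psi> x $ p * pd k \<psi> x $ q * \<Gamma>' (\<psi> x) $ m $ p $ q) =
      (\<Sum>p\<in>UNIV. \<Sum>q\<in>UNIV. pd k \<psi> x $ p * pd i \<psi> x $ q * \<Gamma>' (\<psi> x) $ m $ p $ q)" for m
      by (subst sum.swap) (simp add: sym'[OF maps[OF that], of m] mult_ac)
    ultimately show ?thesis by (simp add: R_def vec_eq_iff)
  qed
  then have symG: "G x $ j $ i $ k = G x $ j $ k $ i" if "(x, y) \<in> U" for x y j i k
    using that by (simp add: G_def)
  have annG: "annihilates L G z" if "z \<in> U" for z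
  proof (cases z)
    case (Pair x y)
    then show ?thesis
      using annihilates_pullback[OF ann'[OF maps]] law[OF base] that by blast
  qed
  have "conn (G x) i y $ j = conn (\<Gamma> x) i y $ j" if "(x, y) \<in> U" for y i j
  proof -
    have "nonlinear_connection L j i (x, y) = conn (G x) i y $ j"
      by (rule annihilates_imp_nonlinear_connection[OF U(1) L(1) inv symG annG that])
    moreover have "nonlinear_connection L j i (x, y) = conn (\<Gamma> x) i y $ j"
      by (rule annihilates_imp_nonlinear_connection[OF U(1) L(1) inv sym ann that])
    ultimately show ?thesis by simp
  qed
  then have "G x $ j $ i $ k = \<Gamma> x $ j $ i $ k" for j i k
    using connection_unique[OF U(1) z] by blast
  then have "G x = \<Gamma> x" by (simp add: vec_eq_iff)
  then show ?thesis using law[OF base[OF z]] by simp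
qed

end

lemma differentiable_vec_nth: "f differentiable net \<Longrightarrow> (\<lambda>x. f x $ i) differentiable net"
  unfolding differentiable_def using has_derivative_vec_nth by blast

lemma has_derivative_fd: "(f has_derivative f') (at x) \<Longrightarrow> (f has_derivative fd f x) (at x)"
  by (simp add: fd_eqI)

lemma conn_add: "conn (\<Gamma> + T) i y $ j = conn \<Gamma> i y $ j + conn T i y $ j"
  by (simp add: conn_def algebra_simps sum.distrib)

section \<open>Levi-Civita symbols and \<open>(\<alpha>,\<beta>)\<close>-metrics in a chart\<close>

locale local_metric =
  fixes W :: "(real^'n::finite) set" and a :: "real^'n \<Rightarrow> real^'n^'n"
  assumes W: "open W" and a: "smooth_on W a"
    and sym: "\<And>x i j. x \<in> W \<Longrightarrow> a x $ i $ j = a x $ j $ i"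
    and nondeg: "\<And>x. x \<in> W \<Longrightarrow> invertible (a x)"
begin

lemma pd_entry: "x \<in> W \<Longrightarrow> pd i (\<lambda>x. a x $ l $ k) x = pd i a x $ l $ k"
  using smooth_on_differentiable[OF a] by (simp add: pd_vec_nth differentiable_vec_nth)

lemma pd_entry_sym: "x \<in> W \<Longrightarrow> pd i (\<lambda>x. a x $ l $ k) x = pd i (\<lambda>x. a x $ k $ l) x"
  by (rule pd_cong[OF W]) (auto intro: sym)

lemma levi_civita_symmetric: "x \<in> W \<Longrightarrow> levi_civita a x $ j $ i $ k = levi_civita a x $ j $ k $ i"
  using pd_entry_sym[of x] by (simp add: levi_civita_def algebra_simps)

lemma smooth_on_levi_civita: "smooth_on W (levi_civita a)"
  unfolding levi_civita_def[abs_def]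
  by (intro smooth_on_vec_lambda smooth_on_mult smooth_on_const smooth_on_sum smooth_on_add smooth_on_diff
      smooth_on_matrix_inv smooth_on_vec_nth smooth_on_pd W a nondeg)

lemma levi_civita_lowered:
  assumes x: "x \<in> W"
  shows "2 * (\<Sum>j\<in>UNIV. a x $ l $ j * levi_civita a x $ j $ i $ k) =
    pd i (\<lambda>x. a x $ l $ k) x + pd k (\<lambda>x. a x $ l $ i) x - pd l (\<lambda>x. a x $ i $ k) x"
proof -
  let ?c = "\<chi> l. pd i (\<lambda>x. a x $ l $ k) x + pd k (\<lambda>x. a x $ l $ i) x - pd l (\<lambda>x. a x $ i $ k) x"
  have "2 * (\<Sum>j\<in>UNIV. a x $ l $ j * levi_civita a x $ j $ i $ k) = (a x *v (matrix_inv (a x) *v ?c)) $ l"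
    by (simp add: levi_civita_def matrix_vector_mult_def sum_distrib_left)
  then show ?thesis by (simp add: matrix_vector_mul_assoc matrix_inv_both nondeg x)
qed

text \<open>Of the three metric derivatives in the Christoffel symbols, the last two cancel on
  contraction with \<open>y\<^sup>l y\<^sup>k\<close>. This is metric compatibility: the quadratic
  form is constant along horizontal lifts.\<close>

lemma levi_civita_contracted:
  assumes x: "x \<in> W"
  shows "2 * (\<Sum>j\<in>UNIV. lower (a x) y j * conn (levi_civita a x) i y $ j) =
    (\<Sum>l\<in>UNIV. \<Sum>k\<in>UNIV. pd i a x $ l $ k * y $ l * y $ k)"
proof -
  let ?c = "\<lambda>m l k. pd m (\<lambda>x. a x $ l $ k) x"
  have "2 * (\<Sum>j\<in>UNIV. lower (a x) y j * conn (levi_civita a x) i y $ j) =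
      (\<Sum>j\<in>UNIV. \<Sum>l\<in>UNIV. \<Sum>k\<in>UNIV. y $ l * y $ k * (2 * (a x $ l $ j * levi_civita a x $ j $ i $ k)))"
  proof -
    have "lower (a x) y j * conn (levi_civita a x) i y $ j =
        (\<Sum>l\<in>UNIV. \<Sum>k\<in>UNIV. y $ l * y $ k * (a x $ l $ j * levi_civita a x $ j $ i $ k))" for j
      by (simp add: lower_def conn_def sum_product sym[OF x] mult_ac)
    then show ?thesis by (simp add: sum_distrib_left mult_ac)
  qed
  also have "\<dots> = (\<Sum>l\<in>UNIV. \<Sum>j\<in>UNIV. \<Sum>k\<in>UNIV. y $ l * y $ k * (2 * (a x $ l $ j * levi_civita a x $ j $ i $ k)))"
    by (rule sum.swap)
  also have "\<dots> = (\<Sum>l\<in>UNIV. \<Sum>k\<in>UNIV. \<Sum>j\<in>UNIV. y $ l * y $ k * (2 * (a x $ l $ j * levi_civita a x $ j $ i $ k)))"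
    by (intro sum.cong refl sum.swap)
  also have "\<dots> = (\<Sum>l\<in>UNIV. \<Sum>k\<in>UNIV. y $ l * y $ k * (?c i l k + ?c k l i - ?c l i k))"
    unfolding levi_civita_lowered[OF x, symmetric] by (simp add: sum_distrib_left)
  also have "\<dots> = (\<Sum>l\<in>UNIV. \<Sum>k\<in>UNIV. y $ l * y $ k * ?c i l k) +
      (\<Sum>l\<in>UNIV. \<Sum>k\<in>UNIV. y $ l * y $ k * ?c k l i) - (\<Sum>l\<in>UNIV. \<Sum>k\<in>UNIV. y $ l * y $ k * ?c l i k)"
    by (simp add: algebra_simps sum.distrib sum_subtractf)
  also have "(\<Sum>l\<in>UNIV. \<Sum>k\<in>UNIV. y $ l * y $ k * ?c k l i) = (\<Sum>l\<in>UNIV. \<Sum>k\<in>UNIV. y $ l * y $ k * ?c l i k)"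
    by (subst sum.swap) (simp add: pd_entry_sym[OF x, of _ _ i] mult_ac)
  finally show ?thesis by (simp add: pd_entry[OF x] mult_ac)
qed

section \<open>The quadratic form of the metric as a Lagrangian\<close>

abbreviation "Q \<equiv> \<lambda>z. quad (a (fst z)) (snd z)"

lemma quad_has_derivative:
  assumes x: "x \<in> W"
  shows "(Q has_derivative (\<lambda>u. (\<Sum>i\<in>UNIV. \<Sum>j\<in>UNIV. fd a x (fst u) $ i $ j * y $ i * y $ j)
    + 2 * (\<Sum>j\<in>UNIV. lower (a x) y j * snd u $ j))) (at (x, y))"
proof -
  have da: "((\<lambda>z. a (fst z)) has_derivative (\<lambda>u. fd a x (fst u))) (at (x, y))"
    by (rule has_derivative_compose[where f=fst and g=a])
      (use smooth_on_has_derivative[OF a x] in \<open>auto intro!: derivative_eq_intros\<close>)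
  have "(Q has_derivative (\<lambda>u. \<Sum>i\<in>UNIV. \<Sum>j\<in>UNIV. fd a x (fst u) $ i $ j * y $ i * y $ j +
      (a x $ i $ j * snd u $ i * y $ j + a x $ i $ j * y $ i * snd u $ j))) (at (x, y))"
    unfolding quad_def by (auto intro!: derivative_eq_intros da simp: algebra_simps)
  moreover have "(\<Sum>i\<in>UNIV. \<Sum>j\<in>UNIV. a x $ i $ j * w $ i * y $ j) = (\<Sum>j\<in>UNIV. lower (a x) y j * w $ j)" for w
    by (simp add: lower_def sum_distrib_left sum_distrib_right mult_ac)
  moreover have "(\<Sum>i\<in>UNIV. \<Sum>j\<in>UNIV. a x $ i $ j * y $ i * w $ j) = (\<Sum>j\<in>UNIV. lower (a x) y j * w $ j)" for w
    by (subst sum.swap) (simp add: lower_def sum_distrib_left sum_distrib_right mult_ac sym[OF x])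
  ultimately show ?thesis by (simp add: sum.distrib)
qed

lemma smooth_on_fst_comp: "smooth_on W f \<Longrightarrow> smooth_on (W \<times> UNIV) (\<lambda>z. f (fst z))"
  by (rule smooth_on_compose[where T=W])
    (auto intro!: W smooth_on_bounded_linear bounded_linear_fst open_Times)

lemma smooth_on_quad: "smooth_on (W \<times> UNIV) Q"
  unfolding quad_def
  by (intro smooth_on_sum smooth_on_mult smooth_on_vec_nth smooth_on_fst_comp a open_Times W open_UNIV
      smooth_on_bounded_linear bounded_linear_snd)

text \<open>Metric compatibility removes all derivatives of the metric, so only \<open>T\<close>
  contributes.\<close>

lemma fd_quad:
  assumes x: "x \<in> W"
  shows "fd Q (x, y) (axis i 1, - conn (levi_civita a x + T) i y) = - 2 * (\<Sum>j\<in>UNIV. lower (a x) y j * conn T i y $ j)"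
proof -
  have "fd Q (x, y) (axis i 1, - conn (levi_civita a x + T) i y) =
      (\<Sum>l\<in>UNIV. \<Sum>k\<in>UNIV. pd i a x $ l $ k * y $ l * y $ k)
      - 2 * (\<Sum>j\<in>UNIV. lower (a x) y j * conn (levi_civita a x) i y $ j)
      - 2 * (\<Sum>j\<in>UNIV. lower (a x) y j * conn T i y $ j)"
    unfolding fd_eqI[OF quad_has_derivative[OF x]]
    by (simp add: conn_add distrib_left sum.distrib sum_negf sum_subtractf right_diff_distrib pd_def)
  then show ?thesis by (simp add: levi_civita_contracted[OF x])
qed

lemma levi_civita_annihilates: "x \<in> W \<Longrightarrow> annihilates Q (levi_civita a) (x, y)"
  using fd_quad[of x y _ 0] by (simp add: annihilates_def) (simp add: conn_def)

text \<open>This turns invertibility of the metric into nondegeneracy of \<open>Q\<close> as a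
  Lagrangian, at every \<open>y\<close> including 0.\<close>

lemma fundamental_tensor_quad:
  assumes x: "x \<in> W"
  shows "fundamental_tensor Q (x, y) = a x"
proof -
  have U: "open (W \<times> (UNIV :: (real^'n) set))" by (simp add: open_Times W)
  have v: "vpd j Q (x, y) = 2 * lower (a x) y j" if "x \<in> W" for j x y
    using fun_cong[OF fd_eqI[OF quad_has_derivative[OF that, of y]], of "(0, axis j 1)"]
      linear_0[OF linear_frechet_derivative[OF smooth_on_differentiable[OF a that]]]
    by (simp add: vpd_def)
  have "vpd i (vpd j Q) (x, y) = 2 * lower (a x) (axis i 1) j" for i j
    by (rule vpd_eqI(2)[OF U _ v smooth_on_differentiable[OF smooth_on_vpd[OF smooth_on_quad]]])
      (use x in \<open>auto intro!: derivative_eq_intros simp: lower_def\<close>)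
  then show ?thesis by (simp add: fundamental_tensor_def vec_eq_iff lower_def sym[OF x])
qed

end

section \<open>The 1-form and the square of an (\<alpha>,\<beta>)-metric\<close>

locale local_alpha_beta = local_metric W a for W :: "(real^'n::finite) set" and a +
  fixes b :: "real^'n \<Rightarrow> real^'n"
  assumes b: "smooth_on W b"
begin

abbreviation "B \<equiv> \<lambda>z. beta (b (fst z)) (snd z)"

lemma beta_has_derivative:
  assumes x: "x \<in> W"
  shows "(B has_derivative (\<lambda>u. \<Sum>j\<in>UNIV. fd b x (fst u) $ j * y $ j + b x $ j * snd u $ j)) (at (x, y))"
proof -
  have "((\<lambda>z. b (fst z)) has_derivative (\<lambda>u. fd b x (fst u))) (at (x, y))"
    by (rule has_derivative_compose[where f=fst and g=b])
      (use smooth_on_has_derivative[OF b x] in \<open>auto intro!: derivative_eq_intros\<close>)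
  then show ?thesis unfolding beta_def by (auto intro!: derivative_eq_intros simp: algebra_simps)
qed

text \<open>Since \<beta> is linear in y, its derivative along the Levi-Civita horizontal lift is
  the covariant derivative of \<open>b\<close> contracted with \<open>y\<close>.\<close>

lemma fd_beta:
  assumes x: "x \<in> W"
  shows "fd B (x, y) (axis i 1, - conn (levi_civita a x + T) i y) =
    (\<Sum>j\<in>UNIV. y $ j * cov_deriv a b i j x) - (\<Sum>j\<in>UNIV. b x $ j * conn T i y $ j)"
proof -
  have "(\<Sum>j\<in>UNIV. y $ j * (\<Sum>k\<in>UNIV. levi_civita a x $ k $ i $ j * b x $ k)) =
      (\<Sum>k\<in>UNIV. b x $ k * conn (levi_civita a x) i y $ k)"
    unfolding conn_def vec_lambda_beta sum_distrib_left by (subst sum.swap) (simp add: mult_ac)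
  moreover have "pd i (\<lambda>x. b x $ j) x = fd b x (axis i 1) $ j" for j
    using pd_vec_nth[OF smooth_on_differentiable[OF b x]] by (simp add: pd_def)
  ultimately have "(\<Sum>j\<in>UNIV. y $ j * cov_deriv a b i j x) =
      (\<Sum>j\<in>UNIV. y $ j * fd b x (axis i 1) $ j) - (\<Sum>k\<in>UNIV. b x $ k * conn (levi_civita a x) i y $ k)"
    by (simp add: cov_deriv_def right_diff_distrib sum_subtractf)
  then show ?thesis
    unfolding fd_eqI[OF beta_has_derivative[OF x]]
    by (simp add: conn_add distrib_left sum.distrib sum_negf sum_subtractf right_diff_distrib mult.commute)
qed

text \<open>One has \<open>2 \<alpha> d\<alpha> = \<epsilon> dQ\<close> and
  \<open>\<alpha> ds = d\<beta> - s d\<alpha>\<close>. Substituting both into the differential of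
  the square of \<alpha> \<phi>(s) leaves only those of Q and \<beta>.\<close>

lemma fd_alpha_beta_square:
  assumes U: "open U" and z: "(x, y) \<in> U" and x: "x \<in> W"
    and L: "\<And>x y. (x, y) \<in> U \<Longrightarrow> L (x, y) = (alpha (a x) y * \<phi> (beta (b x) y / alpha (a x) y))\<^sup>2"
    and \<alpha>: "alpha (a x) y \<noteq> 0"
    and s_def: "s = beta (b x) y / alpha (a x) y"
    and \<phi>: "\<phi> differentiable at s"
  shows "fd L (x, y) u = \<phi> s * (sgn (quad (a x) y) * (\<phi> s - s * deriv \<phi> s) * fd Q (x, y) u
      + 2 * alpha (a x) y * deriv \<phi> s * fd B (x, y) u)"
proof -
  define e where "e = sgn (quad (a x) y)"
  define r where "r = alpha (a x) y"
  have ne: "quad (a x) y \<noteq> 0" using \<alpha> by (auto simp: alpha_def)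
  then have e2: "e * e = 1" and eQ: "e * quad (a x) y > 0"
    by (auto simp: e_def sgn_if)
  have r: "r > 0" "r * r = e * quad (a x) y" "sqrt (e * quad (a x) y) = r"
    using ne by (auto simp: r_def alpha_def e_def sgn_if abs_if real_sqrt_mult_self)
  have dQ: "(Q has_derivative fd Q (x, y)) (at (x, y))"
    by (rule has_derivative_fd[OF quad_has_derivative[OF x]])
  have dB: "(B has_derivative fd B (x, y)) (at (x, y))"
    by (rule has_derivative_fd[OF beta_has_derivative[OF x]])
  \<comment> \<open>The sign \<open>e\<close> is frozen at \<open>(x, y)\<close>. As
    \<open>Q\<close> is nonzero there, this expression equals \<alpha> nearby, and it avoids the
    absolute value.\<close>
  let ?A = "\<lambda>z. sqrt (e * Q z)"
  have dA: "(?A has_derivative (\<lambda>u. e * fd Q (x, y) u / (2 * r))) (at (x, y))"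
    using eQ r(3) by (auto intro!: derivative_eq_intros dQ simp: divide_simps)
  have dS: "((\<lambda>z. B z / ?A z) has_derivative
      (\<lambda>u. (fd B (x, y) u * r - beta (b x) y * (e * fd Q (x, y) u / (2 * r))) / (r * r))) (at (x, y))"
    by (rule has_derivative_eq_rhs[OF has_derivative_divide'[OF dB dA]]) (use r in \<open>auto simp: r(3)\<close>)
  have s: "beta (b x) y / r = s" by (simp add: s_def r_def)
  have "(\<phi> has_field_derivative deriv \<phi> s) (at s)"
    using \<phi> by (simp add: DERIV_deriv_iff_real_differentiable)
  then have "(\<phi> has_derivative (\<lambda>h. deriv \<phi> s * h)) (at (B (x, y) / ?A (x, y)))"
    by (simp add: has_field_derivative_def r(3) s)
  from has_derivative_compose[OF dS this]
  have d\<phi>: "((\<lambda>z. \<phi> (B z / ?A z)) has_derivative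
      (\<lambda>u. deriv \<phi> s * ((fd B (x, y) u * r - beta (b x) y * (e * fd Q (x, y) u / (2 * r))) / (r * r)))) (at (x, y))" .
  have "((\<lambda>z. (?A z * \<phi> (B z / ?A z))\<^sup>2) has_derivative
      (\<lambda>u. 2 * (r * \<phi> s) * (e * fd Q (x, y) u / (2 * r) * \<phi> s + r * (deriv \<phi> s *
        ((fd B (x, y) u * r - beta (b x) y * (e * fd Q (x, y) u / (2 * r))) / (r * r)))))) (at (x, y))"
    by (rule has_derivative_eq_rhs[OF has_derivative_power[OF has_derivative_mult[OF dA d\<phi>], where n=2]])
      (simp add: fun_eq_iff r(3) s)
  then have "(L has_derivative
      (\<lambda>u. 2 * (r * \<phi> s) * (e * fd Q (x, y) u / (2 * r) * \<phi> s + r * (deriv \<phi> s *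
        ((fd B (x, y) u * r - beta (b x) y * (e * fd Q (x, y) u / (2 * r))) / (r * r)))))) (at (x, y))"
  proof (rule has_derivative_transform_eventually)
    have "isCont Q (x, y)" using dQ has_derivative_continuous by blast
    then have "((\<lambda>z. e * Q z) \<longlongrightarrow> e * Q (x, y)) (at (x, y))"
      by (intro tendsto_intros) (simp add: isCont_def)
    then have "\<forall>\<^sub>F z in at (x, y). 0 < e * Q z"
      using eQ by (simp add: order_tendstoD(1))
    moreover have "\<forall>\<^sub>F z in at (x, y). z \<in> U"
      using U z by (simp add: eventually_at_topological) blast
    ultimately show "\<forall>\<^sub>F z in at (x, y). (?A z * \<phi> (B z / ?A z))\<^sup>2 = L z"
    proof eventually_elim
      case (elim z)
      then have "?A z = alpha (a (fst z)) (snd z)"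
        by (auto simp: alpha_def e_def sgn_if abs_if zero_less_mult_iff split: if_splits)
      then show ?case using L[of "fst z" "snd z"] elim by simp
    qed
    show "(?A (x, y) * \<phi> (B (x, y) / ?A (x, y)))\<^sup>2 = L (x, y)"
      using L[OF z] r(3) by (simp add: r_def)
  qed auto
  then have eq: "fd L (x, y) u = 2 * (r * \<phi> s) * (e * fd Q (x, y) u / (2 * r) * \<phi> s + r * (deriv \<phi> s *
        ((fd B (x, y) u * r - beta (b x) y * (e * fd Q (x, y) u / (2 * r))) / (r * r))))"
    by (simp add: fd_eqI)
  have bs: "beta (b x) y = s * r" using r by (simp add: s_def r_def)
  show ?thesis
    unfolding eq bs e_def[symmetric] r_def[symmetric] using r(1) by (simp add: field_simps)
qed

text \<open>The common factor 2 \<alpha> \<phi> of \<open>\<delta>\<^sub>i L\<close> is nonzero and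
  drops out. The equation stays multiplied by \<phi>' so that it also covers the points with \<phi>'
  = 0.\<close>

lemma annihilates_alpha_beta_iff:
  assumes U: "open U" and z: "(x, y) \<in> U" and x: "x \<in> W"
    and L: "\<And>x y. (x, y) \<in> U \<Longrightarrow> L (x, y) = (alpha (a x) y * \<phi> (beta (b x) y / alpha (a x) y))\<^sup>2"
    and \<alpha>: "alpha (a x) y \<noteq> 0"
    and s_def: "s = beta (b x) y / alpha (a x) y"
    and \<phi>: "\<phi> differentiable at s" "\<phi> s \<noteq> 0"
    and \<Gamma>: "\<Gamma> x = levi_civita a x + T"
  shows "annihilates L \<Gamma> (x, y) \<longleftrightarrow>
    (\<forall>i. deriv \<phi> s * (\<Sum>j\<in>UNIV. y $ j * cov_deriv a b i j x) =
      deriv \<phi> s * (\<Sum>j\<in>UNIV. b x $ j * conn T i y $ j) +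
      sgn (quad (a x) y) / alpha (a x) y * (\<phi> s - s * deriv \<phi> s) * (\<Sum>j\<in>UNIV. lower (a x) y j * conn T i y $ j))"
proof -
  have "fd L (x, y) (axis i 1, - conn (\<Gamma> x) i y) = 2 * alpha (a x) y * \<phi> s *
      (deriv \<phi> s * (\<Sum>j\<in>UNIV. y $ j * cov_deriv a b i j x) -
       (deriv \<phi> s * (\<Sum>j\<in>UNIV. b x $ j * conn T i y $ j) +
      sgn (quad (a x) y) / alpha (a x) y * (\<phi> s - s * deriv \<phi> s) * (\<Sum>j\<in>UNIV. lower (a x) y j * conn T i y $ j)))"
    for i
  proof -
    have eq: "fd L (x, y) (axis i 1, - conn (\<Gamma> x) i y) = \<phi> s * (sgn (quad (a x) y) * (\<phi> s - s * deriv \<phi> s) *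
          (- 2 * (\<Sum>j\<in>UNIV. lower (a x) y j * conn T i y $ j))
        + 2 * alpha (a x) y * deriv \<phi> s *
          ((\<Sum>j\<in>UNIV. y $ j * cov_deriv a b i j x) - (\<Sum>j\<in>UNIV. b x $ j * conn T i y $ j)))"
      unfolding \<Gamma> fd_quad[OF x, symmetric] fd_beta[OF x, symmetric]
      by (rule fd_alpha_beta_square[OF U z x L \<alpha> s_def \<phi>(1)])
    show ?thesis unfolding eq using \<alpha> by (simp add: field_simps)
  qed
  then show ?thesis using \<phi>(2) \<alpha> by (simp add: annihilates_def)
qed

end

section \<open>Globalisation\<close>

lemma ball_case_prod_iff: "(\<forall>(x, y)\<in>S. P x y) \<longleftrightarrow> (\<forall>x y. (x, y) \<in> S \<longrightarrow> P x y)"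
  by auto

section \<open>Charts, transitions and transformation laws\<close>

locale manifold =
  fixes X :: "'m topology" and \<C> :: "('m, 'n::finite) chart set"
  assumes manifold: "smooth_manifold X \<C>"
begin

lemma open_chart_image: "c \<in> \<C> \<Longrightarrow> open (chart_image c)"
  using manifold by (simp add: smooth_manifold_def)

lemma smooth_transition: "c \<in> \<C> \<Longrightarrow> c' \<in> \<C> \<Longrightarrow> smooth_on (chart_overlap c c') (transition c c')"
  using manifold by (simp add: smooth_manifold_def)

lemma inj_chart: assumes "c \<in> \<C>" shows "inj_on (snd c) (fst c)"
proof -
  have "homeomorphic_map (subtopology X (fst c)) (top_of_set (chart_image c)) (snd c)" "openin X (fst c)"
    using manifold assms by (auto simp: smooth_manifold_def)
  then show ?thesis
    using homeomorphic_imp_injective_map[of "subtopology X (fst c)"]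
    by (simp add: Int_absorb1 openin_subset)
qed

lemma open_chart_overlap: assumes "c \<in> \<C>" "c' \<in> \<C>" shows "open (chart_overlap c c')"
proof -
  have "homeomorphic_map (subtopology X (fst c)) (top_of_set (chart_image c)) (snd c)"
    "openin X (fst c)" "openin X (fst c')"
    using manifold assms by (auto simp: smooth_manifold_def)
  moreover have "openin (subtopology X (fst c)) (fst c \<inter> fst c')"
    using \<open>openin X (fst c')\<close> by (auto simp: openin_subtopology)
  ultimately have "openin (top_of_set (chart_image c)) (snd c ` (fst c \<inter> fst c'))"
    using homeomorphic_imp_open_map open_map_def by blast
  then show ?thesis
    using open_chart_image[OF assms(1)] by (simp add: chart_overlap_def openin_open_eq)
qed

lemma overlap_subset: "chart_overlap c c' \<subseteq> chart_image c"
  by (auto simp: chart_overlap_def chart_image_def)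

lemma transition_eq: "c \<in> \<C> \<Longrightarrow> p \<in> fst c \<Longrightarrow> transition c c' (snd c p) = snd c' p"
  by (simp add: transition_def inj_chart)

lemma transition_overlap:
  assumes "c \<in> \<C>" "c' \<in> \<C>" "x \<in> chart_overlap c c'"
  shows "transition c c' x \<in> chart_overlap c' c" "transition c' c (transition c c' x) = x"
proof -
  obtain p where p: "p \<in> fst c" "p \<in> fst c'" "x = snd c p" using assms(3) by (auto simp: chart_overlap_def)
  have eq: "transition c c' x = snd c' p" unfolding p(3) by (rule transition_eq[OF assms(1) p(1)])
  show "transition c c' x \<in> chart_overlap c' c"
    unfolding eq chart_overlap_def using p(1,2) by blast
  show "transition c' c (transition c c' x) = x"
    unfolding eq using transition_eq[OF assms(2) p(2), of c] p(3) by simp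
qed

text \<open>Differentiating the identity between a transition and its reverse gives a left inverse,
  which is two-sided for square matrices.\<close>

lemma invertible_jacobian:
  assumes c: "c \<in> \<C>" "c' \<in> \<C>" and x: "x \<in> chart_overlap c c'"
  shows "invertible (\<chi> m j. pd j (transition c c') x $ m)"
proof -
  let ?f = "transition c c'" and ?g = "transition c' c"
  note df = smooth_on_has_derivative[OF smooth_transition[OF c] x]
  note dg = smooth_on_has_derivative[OF smooth_transition[OF c(2,1)] transition_overlap(1)[OF c x]]
  have "((\<lambda>x. x) has_derivative (\<lambda>v. fd ?g (?f x) (fd ?f x v))) (at x)"
    by (rule has_derivative_transform_within_open[OF has_derivative_compose[OF df dg] open_chart_overlap[OF c] x])
      (rule transition_overlap(2)[OF c])
  then have "(\<lambda>v. fd ?g (?f x) (fd ?f x v)) = (\<lambda>v. v)"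
    using has_derivative_unique has_derivative_ident by blast
  from fun_cong[OF this] have id: "fd ?g (?f x) (fd ?f x v) = v" for v .
  let ?F = "\<chi> m j. pd j ?f x $ m" and ?G = "\<chi> m j. pd j ?g (?f x) $ m"
  have F: "fd ?f x v = ?F *v v" for v
    using fd_vec[OF smooth_on_differentiable[OF smooth_transition[OF c] x], of v]
    by (simp add: vec_eq_iff matrix_vector_mult_def mult.commute)
  have G: "fd ?g (?f x) v = ?G *v v" for v
    using fd_vec[OF smooth_on_differentiable[OF smooth_transition[OF c(2,1)] transition_overlap(1)[OF c x]], of v]
    by (simp add: vec_eq_iff matrix_vector_mult_def mult.commute)
  have "(?G ** ?F) *v v = mat 1 *v v" for v
    using id[of v] by (simp add: F G matrix_vector_mul_assoc)
  then have "?G ** ?F = mat 1" by (simp add: matrix_eq)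
  then show ?thesis using matrix_left_right_inverse[of ?G ?F] by (auto simp: invertible_def)
qed

lemma dtr_eq:
  assumes "c \<in> \<C>" "c' \<in> \<C>" "x \<in> chart_overlap c c'"
  shows "dtr c c' i k x = pd i (transition c c') x $ k"
  using pd_vec_nth[OF smooth_on_differentiable[OF smooth_transition[OF assms(1,2)] assms(3)]]
  by (simp add: dtr_def)

lemma pd_dtr_eq:
  assumes c: "c \<in> \<C>" "c' \<in> \<C>" and x: "x \<in> chart_overlap c c'"
  shows "pd i (dtr c c' k m) x = pd i (pd k (transition c c')) x $ m"
  by (subst pd_vec_nth[OF smooth_on_differentiable[OF smooth_on_pd[OF smooth_transition[OF c]] x], symmetric])
    (rule pd_cong[OF open_chart_overlap[OF c] x dtr_eq[OF c]])

lemma connection_law_iff: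
  assumes c: "c \<in> \<C>" "c' \<in> \<C>" and x: "x \<in> chart_overlap c c'"
  shows "connection_law (transition c c') G G' x \<longleftrightarrow> (\<forall>m i k. (\<Sum>j\<in>UNIV. dtr c c' j m x * G $ j $ i $ k) =
        pd i (dtr c c' k m) x +
        (\<Sum>p\<in>UNIV. \<Sum>q\<in>UNIV. dtr c c' i p x * dtr c c' k q x * G' $ m $ p $ q))"
  by (simp add: connection_law_def dtr_eq[OF c x] pd_dtr_eq[OF c x])

text \<open>The second-derivative terms of the two laws coincide and cancel, which leaves the
  tensorial law.\<close>

lemma connection_difference:
  assumes "torsion_free_affine_connection \<C> \<Gamma>" "torsion_free_affine_connection \<C> \<Gamma>'"
  shows "symmetric_tensor12 \<C> (\<lambda>c x. \<Gamma> c x - \<Gamma>' c x)"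
  using assms unfolding torsion_free_affine_connection_def symmetric_tensor12_def
  by (auto intro!: smooth_on_diff open_chart_image simp: right_diff_distrib sum_subtractf)

lemma tcoord_transition:
  assumes "c \<in> \<C>" "c' \<in> \<C>" "w \<in> tdom \<C> c" "fst w \<in> fst c'"
  shows "snd w c' = fd (transition c c') (snd c (fst w)) (snd w c)"
  using assms by (simp only: tdom_def tangent_bundle_def mem_Collect_eq split_beta) blast

lemma tcoord_zero:
  assumes "w \<in> tdom \<C> c" "\<not> (d \<in> \<C> \<and> fst w \<in> fst d)"
  shows "snd w d = 0"
  using assms by (simp only: tdom_def tangent_bundle_def mem_Collect_eq split_beta) blast

text \<open>The components in other charts around the base point follow from those in
  \<open>c\<close>, and all remaining ones are normalised to 0. This makes the
  \<open>inv_into\<close> in \<open>fun_in_coords\<close> a genuine inverse on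
  \<open>tdom \<C> c\<close>.\<close>

lemma inj_on_tcoord:
  assumes c: "c \<in> \<C>"
  shows "inj_on (tcoord c) (tdom \<C> c)"
proof (rule inj_onI)
  fix w w' assume w: "w \<in> tdom \<C> c" "w' \<in> tdom \<C> c" and eq: "tcoord c w = tcoord c w'"
  have p: "fst w = fst w'"
    using eq w inj_onD[OF inj_chart[OF c]] by (simp add: tcoord_def tdom_def)
  moreover have "snd w d = snd w' d" for d
  proof (cases "d \<in> \<C> \<and> fst w \<in> fst d")
    case True
    then show ?thesis
      using tcoord_transition[OF c, of d w] tcoord_transition[OF c, of d w'] w eq p by (simp add: tcoord_def)
  next
    case False
    then show ?thesis using w p tcoord_zero[of w c d] tcoord_zero[of w' c d] by simp
  qed
  ultimately show "w = w'" by (simp add: prod_eq_iff fun_eq_iff)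
qed

lemma fun_in_coords_tcoord: "c \<in> \<C> \<Longrightarrow> w \<in> tdom \<C> c \<Longrightarrow> fun_in_coords \<C> c F (tcoord c w) = F w"
  by (simp add: fun_in_coords_def inj_on_tcoord)

lemma represents_N_iff: "represents_N \<C> A F \<Gamma> \<longleftrightarrow> (\<forall>c\<in>\<C>. \<forall>x y. (x, y) \<in> in_coords \<C> c A \<longrightarrow>
    (\<forall>j i. nonlinear_connection (L_in_coords \<C> c F) j i (x, y) = conn (\<Gamma> c x) i y $ j))"
  by (simp only: represents_N_def conn_def vec_lambda_beta ball_case_prod_iff)

end

section \<open>Coordinates on a conic subbundle\<close>

locale conic_manifold = manifold X \<C> for X :: "'m topology" and \<C> :: "('m, 'n::finite) chart set" +
  fixes A :: "('m, 'n) tvec set"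
  assumes conic: "conic_subbundle \<C> A"
begin

lemma open_in_coords: "c \<in> \<C> \<Longrightarrow> open (in_coords \<C> c A)"
  using conic by (simp add: conic_subbundle_def)

lemma in_coordsE:
  assumes "(x, y) \<in> in_coords \<C> c A"
  obtains w where "w \<in> A" "w \<in> tdom \<C> c" "tcoord c w = (x, y)"
  using assms by (auto simp: in_coords_def)

lemma in_coords_base: "(x, y) \<in> in_coords \<C> c A \<Longrightarrow> x \<in> chart_image c"
  by (auto simp: in_coords_def tcoord_def tdom_def chart_image_def)

text \<open>The cone projects onto M. A vector over \<open>x\<close> is what ties the coefficients
  at \<open>x\<close> to the nonlinear connection.\<close>

lemma in_coords_fibre:
  assumes "c \<in> \<C>" "x \<in> chart_image c"
  shows "\<exists>y. (x, y) \<in> in_coords \<C> c A"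
proof -
  obtain p where p: "p \<in> fst c" "x = snd c p" using assms by (auto simp: chart_image_def)
  then have "p \<in> fst ` A" using conic assms by (auto simp: conic_subbundle_def)
  then obtain w where w: "w \<in> A" "fst w = p" by blast
  then have "w \<in> tdom \<C> c" using p conic by (auto simp: conic_subbundle_def tdom_def)
  then have "tcoord c w \<in> in_coords \<C> c A" using w by (auto simp: in_coords_def)
  then show ?thesis using w p by (auto simp: tcoord_def)
qed

lemma tscale_tcoord:
  assumes "w \<in> A" "w \<in> tdom \<C> c" "r > 0"
  shows "tscale r w \<in> A" "tscale r w \<in> tdom \<C> c" "tcoord c (tscale r w) = (fst (tcoord c w), r *\<^sub>R snd (tcoord c w))"
proof -
  show A: "tscale r w \<in> A" using conic assms by (auto simp: conic_subbundle_def)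
  then have "tscale r w \<in> tangent_bundle \<C>" using conic by (auto simp: conic_subbundle_def)
  then show "tscale r w \<in> tdom \<C> c" using assms by (auto simp: tdom_def tscale_def)
  show "tcoord c (tscale r w) = (fst (tcoord c w), r *\<^sub>R snd (tcoord c w))"
    by (simp add: tcoord_def tscale_def)
qed

lemma in_coords_cone:
  assumes "(x, y) \<in> in_coords \<C> c A" "r > 0"
  shows "(x, r *\<^sub>R y) \<in> in_coords \<C> c A"
proof -
  obtain w where w: "w \<in> A" "w \<in> tdom \<C> c" "tcoord c w = (x, y)"
    using in_coordsE[OF assms(1)] by blast
  have "tcoord c (tscale r w) \<in> in_coords \<C> c A"
    using tscale_tcoord(1,2)[OF w(1,2) assms(2)] by (auto simp: in_coords_def)
  then show ?thesis using tscale_tcoord(3)[OF w(1,2) assms(2)] w(3) by simp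
qed

lemma in_coords_change:
  assumes c: "c \<in> \<C>" "c' \<in> \<C>" and z: "(x, y) \<in> in_coords \<C> c A" and x: "x \<in> chart_overlap c c'"
  shows "(transition c c' x, fd (transition c c') x y) \<in> in_coords \<C> c' A"
    and "fun_in_coords \<C> c F (x, y) = fun_in_coords \<C> c' F (transition c c' x, fd (transition c c') x y)"
proof -
  obtain w where w: "w \<in> A" "w \<in> tdom \<C> c" "tcoord c w = (x, y)"
    using in_coordsE[OF z] by blast
  obtain p where p: "p \<in> fst c" "p \<in> fst c'" "x = snd c p"
    using x by (auto simp: chart_overlap_def)
  have "fst w = p"
    using w p inj_onD[OF inj_chart[OF c(1)]] by (auto simp: tcoord_def tdom_def)
  then have w': "w \<in> tdom \<C> c'" "tcoord c' w = (transition c c' x, fd (transition c c') x y)"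
    using w p tcoord_transition[OF c w(2)] transition_eq[OF c(1)] by (auto simp: tcoord_def tdom_def)
  then show "(transition c c' x, fd (transition c c') x y) \<in> in_coords \<C> c' A"
    using w(1) unfolding in_coords_def by (metis IntI image_eqI)
  show "fun_in_coords \<C> c F (x, y) = fun_in_coords \<C> c' F (transition c c' x, fd (transition c c') x y)"
    using fun_in_coords_tcoord[OF c(1) w(2)] fun_in_coords_tcoord[OF c(2) w'(1)] w(3) w'(2) by metis
qed

end

section \<open>Connections representing the nonlinear connection of a Finsler metric\<close>

locale finsler_manifold = conic_manifold X \<C> A
  for X :: "'m topology" and \<C> :: "('m, 'n::finite) chart set" and A +
  fixes F :: "('m, 'n) tvec \<Rightarrow> real"
  assumes finsler: "finsler_metric \<C> A F"
begin

abbreviation "L c \<equiv> L_in_coords \<C> c F"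

lemma L_square: "L c z = (fun_in_coords \<C> c F z)\<^sup>2"
  by (simp add: L_in_coords_def fun_in_coords_def)

lemma smooth_on_F: "c \<in> \<C> \<Longrightarrow> smooth_on (in_coords \<C> c A) (fun_in_coords \<C> c F)"
  using finsler by (simp add: finsler_metric_def)

lemma smooth_on_L: "c \<in> \<C> \<Longrightarrow> smooth_on (in_coords \<C> c A) (L c)"
  by (rule smooth_on_cong[OF open_in_coords _ smooth_on_mult[OF open_in_coords smooth_on_F smooth_on_F]])
    (simp_all add: L_square power2_eq_square)

lemma invertible_fundamental_tensor:
  "c \<in> \<C> \<Longrightarrow> z \<in> in_coords \<C> c A \<Longrightarrow> invertible (fundamental_tensor (L c) z)"
  using finsler by (simp add: finsler_metric_def)

lemma homogeneous_lagrangian_L: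
  assumes c: "c \<in> \<C>"
  shows "homogeneous_lagrangian (in_coords \<C> c A) (L c)"
proof
  fix x y r assume z: "(x, y) \<in> in_coords \<C> c A" and r: "r > (0::real)"
  obtain w where w: "w \<in> A" "w \<in> tdom \<C> c" "tcoord c w = (x, y)"
    using in_coordsE[OF z] by blast
  have "tcoord c (tscale r w) = (x, r *\<^sub>R y)"
    unfolding tscale_tcoord(3)[OF w(1,2) r] w(3) by simp
  then have "fun_in_coords \<C> c F (x, r *\<^sub>R y) = F (tscale r w)"
    using fun_in_coords_tcoord[OF c tscale_tcoord(2)[OF w(1,2) r], of F] by simp
  also have "\<dots> = r * F w"
    using finsler w(1) r unfolding finsler_metric_def by blast
  also have "F w = fun_in_coords \<C> c F (x, y)"
    using fun_in_coords_tcoord[OF c w(2), of F] w(3) by simp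
  finally show "L c (x, r *\<^sub>R y) = r\<^sup>2 * L c (x, y)"
    by (simp add: L_square power_mult_distrib)
qed (use c open_in_coords smooth_on_L in_coords_cone in auto)

text \<open>Symmetry has to be demanded on the right: for a quadratic Lagrangian, metric connections
  with torsion also satisfy \<open>\<delta>\<^sub>i L = 0\<close>, yet they do not give N.\<close>

lemma represents_N_iff_annihilates:
  "represents_N \<C> A F \<Gamma> \<longleftrightarrow> (\<forall>c\<in>\<C>.
     (\<forall>x\<in>chart_image c. \<forall>j i k. \<Gamma> c x $ j $ i $ k = \<Gamma> c x $ j $ k $ i) \<and>
     (\<forall>z\<in>in_coords \<C> c A. annihilates (L c) (\<Gamma> c) z))" (is "?N \<longleftrightarrow> ?R")
proof
  assume ?N
  show ?R
  proof (intro ballI conjI allI)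
    fix c assume c: "c \<in> \<C>"
    interpret homogeneous_lagrangian "in_coords \<C> c A" "L c" by (rule homogeneous_lagrangian_L[OF c])
    have N: "nonlinear_connection (L c) j i (x, y) = conn (\<Gamma> c x) i y $ j"
      if "(x, y) \<in> in_coords \<C> c A" for x y j i
      using \<open>?N\<close> that c by (simp add: represents_N_iff)
    note inv = invertible_fundamental_tensor[OF c]
    show "\<Gamma> c x $ j $ i $ k = \<Gamma> c x $ j $ k $ i" if x: "x \<in> chart_image c" for x j i k
    proof -
      obtain y where y: "(x, y) \<in> in_coords \<C> c A" using in_coords_fibre[OF c x] by blast
      show ?thesis by (rule nonlinear_connection_imp_annihilates(1)[OF inv N y])
    qed
    show "annihilates (L c) (\<Gamma> c) z" if "z \<in> in_coords \<C> c A" for z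
    proof (cases z)
      case (Pair x y)
      have "annihilates (L c) (\<Gamma> c) (x, y)"
        by (rule nonlinear_connection_imp_annihilates(2)[OF inv N]) (use that Pair in auto)
      then show ?thesis by (simp add: Pair)
    qed
  qed
next
  assume R: ?R
  show ?N
    unfolding represents_N_iff
  proof (intro ballI allI impI)
    fix c x y j i assume c: "c \<in> \<C>" and z: "(x, y) \<in> in_coords \<C> c A"
    show "nonlinear_connection (L c) j i (x, y) = conn (\<Gamma> c x) i y $ j"
      by (rule annihilates_imp_nonlinear_connection[OF open_in_coords[OF c] smooth_on_L[OF c]
            invertible_fundamental_tensor[OF c] _ _ z])
        (use R c in_coords_base in blast)+
  qed
qed

lemma represents_N_unique:
  assumes "represents_N \<C> A F \<Gamma>" "represents_N \<C> A F \<Gamma>'" and c: "c \<in> \<C>" and x: "x \<in> chart_image c"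
  shows "\<Gamma> c x $ j $ i $ k = \<Gamma>' c x $ j $ i $ k"
proof -
  obtain y where "(x, y) \<in> in_coords \<C> c A" using in_coords_fibre[OF c x] by blast
  then show ?thesis
    by (rule connection_unique[OF open_in_coords[OF c]])
      (use assms in \<open>auto simp: represents_N_iff\<close>)
qed

text \<open>The assumption is only an equation in each chart. Smoothness is inherited from N,
  symmetry comes from the homogeneity of the spray, and the law from the naturality of
  \<open>annihilates\<close>.\<close>

lemma represents_N_torsion_free:
  assumes N: "represents_N \<C> A F \<Gamma>"
  shows "torsion_free_affine_connection \<C> \<Gamma>"
proof -
  note R = N[unfolded represents_N_iff_annihilates]
  have "smooth_on (chart_image c) (\<Gamma> c)" if c: "c \<in> \<C>" for c
    by (rule smooth_on_connection[OF open_in_coords[OF c] smooth_on_L[OF c] invertible_fundamental_tensor[OF c]])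
      (use N c in_coords_fibre[OF c] in \<open>auto simp: represents_N_iff\<close>)
  moreover have "connection_law (transition c c') (\<Gamma> c x) (\<Gamma> c' (transition c c' x)) x"
    if c: "c \<in> \<C>" "c' \<in> \<C>" and x: "x \<in> chart_overlap c c'" for c c' x
  proof -
    \<comment> \<open>Restricting to base points in the overlap keeps the fibres of the cone whole,
      so the coefficients are still determined.\<close>
    let ?U = "in_coords \<C> c A \<inter> chart_overlap c c' \<times> UNIV"
    have "open ?U" by (intro open_Int open_Times open_in_coords open_chart_overlap c open_UNIV)
    then interpret tangent_map "chart_overlap c c'" "transition c c'" ?U "in_coords \<C> c' A" "L c" "L c'"
      by unfold_locales
        (use c in_coords_change[OF c] smooth_on_subset[OF smooth_on_L[OF c(1)], of ?U] in
          \<open>auto simp: open_chart_overlap smooth_transition open_in_coords smooth_on_L L_square\<close>)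
    obtain y where "(x, y) \<in> ?U"
      using in_coords_fibre[OF c(1)] x overlap_subset by blast
    then show ?thesis
      by (rule connection_transforms[rotated -1])
        (use R c in_coords_base invertible_fundamental_tensor invertible_jacobian[OF c] in blast)+
  qed
  ultimately show ?thesis
    using R unfolding torsion_free_affine_connection_def by (simp add: connection_law_iff)
qed

end

section \<open>The Berwald condition for (\<alpha>,\<beta>)-metrics\<close>

locale alpha_beta_manifold = finsler_manifold X \<C> A F
  for X :: "'m topology" and \<C> :: "('m, 'n::finite) chart set" and A and F +
  fixes a :: "('m, 'n) chart \<Rightarrow> real^'n \<Rightarrow> real^'n^'n" and b :: "('m, 'n) chart \<Rightarrow> real^'n \<Rightarrow> real^'n"
    and D :: "real set" and \<phi> :: "real \<Rightarrow> real"
  assumes metric: "pseudo_riemannian_metric \<C> a"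
    and form: "one_form \<C> b"
    and alpha_beta: "alpha_beta_metric \<C> A a b D \<phi> F"
begin

lemma local_alpha_beta: "c \<in> \<C> \<Longrightarrow> local_alpha_beta (chart_image c) (a c) (b c)"
  using metric form open_chart_image
  by unfold_locales (auto simp: pseudo_riemannian_metric_def one_form_def)

lemma quad_transition:
  assumes c: "c \<in> \<C>" "c' \<in> \<C>" and x: "x \<in> chart_overlap c c'"
  shows "quad (a c x) y = quad (a c' (transition c c' x)) (fd (transition c c') x y)"
proof -
  let ?a = "a c' (transition c c' x)" and ?d = "\<lambda>i k. dtr c c' i k x"
  have d: "fd (transition c c') x y $ k = (\<Sum>i\<in>UNIV. ?d i k * y $ i)" for k
    by (simp add: fd_vec[OF smooth_on_differentiable[OF smooth_transition[OF c] x]] dtr_eq[OF c x] mult.commute)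
  have "quad (a c x) y = (\<Sum>i\<in>UNIV. \<Sum>j\<in>UNIV. (\<Sum>k\<in>UNIV. \<Sum>l\<in>UNIV. ?d i k * ?d j l * ?a $ k $ l) * y $ i * y $ j)"
    using metric c x by (simp add: quad_def pseudo_riemannian_metric_def)
  also have "\<dots> = (\<Sum>i\<in>UNIV. \<Sum>j\<in>UNIV. \<Sum>k\<in>UNIV. \<Sum>l\<in>UNIV. ?a $ k $ l * (?d i k * y $ i) * (?d j l * y $ j))"
    by (simp add: sum_distrib_left sum_distrib_right mult_ac)
  also have "\<dots> = (\<Sum>i\<in>UNIV. \<Sum>k\<in>UNIV. \<Sum>j\<in>UNIV. \<Sum>l\<in>UNIV. ?a $ k $ l * (?d i k * y $ i) * (?d j l * y $ j))"
    by (intro sum.cong refl sum.swap)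
  also have "\<dots> = (\<Sum>k\<in>UNIV. \<Sum>i\<in>UNIV. \<Sum>j\<in>UNIV. \<Sum>l\<in>UNIV. ?a $ k $ l * (?d i k * y $ i) * (?d j l * y $ j))"
    by (rule sum.swap)
  also have "\<dots> = (\<Sum>k\<in>UNIV. \<Sum>i\<in>UNIV. \<Sum>l\<in>UNIV. \<Sum>j\<in>UNIV. ?a $ k $ l * (?d i k * y $ i) * (?d j l * y $ j))"
    by (intro sum.cong refl sum.swap)
  also have "\<dots> = (\<Sum>k\<in>UNIV. \<Sum>l\<in>UNIV. \<Sum>i\<in>UNIV. \<Sum>j\<in>UNIV. ?a $ k $ l * (?d i k * y $ i) * (?d j l * y $ j))"
    by (intro sum.cong refl sum.swap)
  also have "\<dots> = quad ?a (fd (transition c c') x y)"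
    by (simp add: quad_def d sum_product sum_distrib_left sum_distrib_right mult_ac)
  finally show ?thesis .
qed

text \<open>The quadratic forms in two charts correspond under the tangent map, so the uniqueness
  argument for Lagrangians yields the law and no Christoffel symbol is transformed by hand.\<close>

lemma levi_civita_torsion_free: "torsion_free_affine_connection \<C> (\<lambda>c. levi_civita (a c))"
proof -
  have "connection_law (transition c c') (levi_civita (a c) x) (levi_civita (a c') (transition c c' x)) x"
    if c: "c \<in> \<C>" "c' \<in> \<C>" and x: "x \<in> chart_overlap c c'" for c c' x
  proof -
    interpret M: local_alpha_beta "chart_image c" "a c" "b c" by (rule local_alpha_beta[OF c(1)])
    interpret M': local_alpha_beta "chart_image c'" "a c'" "b c'" by (rule local_alpha_beta[OF c(2)])
    have sub: "transition c c' x \<in> chart_image c'" if "x \<in> chart_overlap c c'" for x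
      using transition_overlap(1)[OF c that] overlap_subset by blast
    have in_chart: "x \<in> chart_image c" if "x \<in> chart_overlap c c'" for x
      using that overlap_subset by blast
    interpret tangent_map "chart_overlap c c'" "transition c c'" "chart_overlap c c' \<times> UNIV" "chart_image c' \<times> UNIV"
      "\<lambda>z. quad (a c (fst z)) (snd z)" "\<lambda>z. quad (a c' (fst z)) (snd z)"
      by unfold_locales
        (use c sub in_chart smooth_on_subset[OF M.smooth_on_quad, of "chart_overlap c c' \<times> UNIV"] M'.smooth_on_quad quad_transition[OF c] in
          \<open>auto simp: open_chart_overlap open_chart_image smooth_transition open_Times\<close>)
    \<comment> \<open>The fibres are whole tangent spaces here, so the zero vector can serve as the
      point over \<open>x\<close>.\<close>
    have "(x, 0) \<in> chart_overlap c c' \<times> (UNIV :: (real^'n) set)" using x by simp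
    then show ?thesis
      by (rule connection_transforms[rotated -1])
        (auto simp: M.fundamental_tensor_quad[OF in_chart] M.nondeg[OF in_chart]
          intro: M.levi_civita_symmetric[OF in_chart] M.levi_civita_annihilates[OF in_chart]
            M'.levi_civita_symmetric M'.levi_civita_annihilates invertible_jacobian[OF c])
  qed
  moreover have "smooth_on (chart_image c) (levi_civita (a c))" if "c \<in> \<C>" for c
  proof -
    interpret local_alpha_beta "chart_image c" "a c" "b c" by (rule local_alpha_beta[OF that])
    show ?thesis by (rule smooth_on_levi_civita)
  qed
  moreover have "levi_civita (a c) x $ j $ i $ k = levi_civita (a c) x $ j $ k $ i"
    if "c \<in> \<C>" "x \<in> chart_image c" for c x j i k
  proof -
    interpret local_alpha_beta "chart_image c" "a c" "b c" by (rule local_alpha_beta[OF that(1)])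
    show ?thesis by (rule levi_civita_symmetric[OF that(2)])
  qed
  ultimately show ?thesis
    unfolding torsion_free_affine_connection_def by (simp add: connection_law_iff)
qed

lemma berwald_condition_iff:
  "berwald_condition \<C> A a b \<phi> T \<longleftrightarrow>
    (\<forall>c\<in>\<C>. \<forall>z\<in>in_coords \<C> c A. annihilates (L c) (\<lambda>x. levi_civita (a c) x + T c x) z)"
proof -
  have "(let \<alpha> = alpha (a c x) y; \<beta> = beta (b c x) y; s = \<beta> / \<alpha>; \<epsilon> = sgn (quad (a c x) y) in
        (deriv \<phi> s \<noteq> 0 \<longrightarrow> (\<forall>i.
           (\<Sum>j\<in>UNIV. y $ j * cov_deriv (a c) (b c) i j x) =
           (\<Sum>j\<in>UNIV. \<Sum>k\<in>UNIV. T c x $ j $ i $ k * y $ k *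
              (b c x $ j + \<epsilon> / \<alpha> * (\<phi> s / deriv \<phi> s - \<beta> / \<alpha>) * lower (a c x) y j)))) \<and>
        (deriv \<phi> s = 0 \<longrightarrow> (\<forall>i.
           (\<Sum>j\<in>UNIV. \<Sum>k\<in>UNIV. T c x $ j $ i $ k * y $ k * lower (a c x) y j) = 0))) \<longleftrightarrow>
      annihilates (L c) (\<lambda>x. levi_civita (a c) x + T c x) (x, y)" (is "?B \<longleftrightarrow> ?A")
    if c: "c \<in> \<C>" and z: "(x, y) \<in> in_coords \<C> c A" for c x y
  proof -
    interpret homogeneous_lagrangian "in_coords \<C> c A" "L c" by (rule homogeneous_lagrangian_L[OF c])
    interpret local_alpha_beta "chart_image c" "a c" "b c" by (rule local_alpha_beta[OF c])
    have F: "alpha (a c x) y \<noteq> 0 \<and> beta (b c x) y / alpha (a c x) y \<in> D \<and>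
        fun_in_coords \<C> c F (x, y) = alpha (a c x) y * \<phi> (beta (b c x) y / alpha (a c x) y)"
      if z: "(x, y) \<in> in_coords \<C> c A" for x y
    proof -
      obtain w where w: "w \<in> A" "w \<in> tdom \<C> c" "tcoord c w = (x, y)"
        using in_coordsE[OF z] by blast
      then show ?thesis
        using alpha_beta c fun_in_coords_tcoord[OF c w(2), of F]
        by (auto simp: alpha_beta_metric_def split: prod.splits)
    qed
    define r s e where "r = alpha (a c x) y" and "s = beta (b c x) y / alpha (a c x) y"
      and "e = sgn (quad (a c x) y)"
    have r: "r \<noteq> 0" using F[OF z] by (simp add: r_def)
    then have e: "e \<noteq> 0" by (auto simp: r_def e_def alpha_def sgn_if)
    \<comment> \<open>\<alpha> vanishes at the zero vector, so the cone avoids it, as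
      \<open>square_root_nonzero\<close> requires.\<close>
    have y: "y \<noteq> 0" using r by (auto simp: r_def alpha_def quad_def)
    have "fun_in_coords \<C> c F (x, y) \<noteq> 0"
      by (rule square_root_nonzero[OF smooth_on_F[OF c] L_square invertible_fundamental_tensor[OF c] z y])
    then have \<phi>: "\<phi> s \<noteq> 0" using F[OF z] by (simp add: s_def)
    have d: "\<phi> differentiable at s"
      using alpha_beta F[OF z] smooth_on_differentiable by (auto simp: alpha_beta_metric_def s_def)
    let ?P = "\<lambda>i. \<Sum>j\<in>UNIV. y $ j * cov_deriv (a c) (b c) i j x"
    let ?b = "\<lambda>i. \<Sum>j\<in>UNIV. b c x $ j * conn (T c x) i y $ j"
    let ?l = "\<lambda>i. \<Sum>j\<in>UNIV. lower (a c x) y j * conn (T c x) i y $ j"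
    have A: "?A \<longleftrightarrow> (\<forall>i. deriv \<phi> s * ?P i = deriv \<phi> s * ?b i + e / r * (\<phi> s - s * deriv \<phi> s) * ?l i)"
      unfolding r_def e_def
      by (rule annihilates_alpha_beta_iff[OF open_in_coords[OF c] z in_coords_base[OF z] _ _ s_def d \<phi>])
        (use F z in \<open>auto simp: L_square\<close>)
    have S: "(\<Sum>j\<in>UNIV. \<Sum>k\<in>UNIV. T c x $ j $ i $ k * y $ k * f j) = (\<Sum>j\<in>UNIV. f j * conn (T c x) i y $ j)" for i f
      by (simp add: conn_def sum_distrib_left mult_ac)
    have S': "(\<Sum>j\<in>UNIV. (b c x $ j + k * lower (a c x) y j) * conn (T c x) i y $ j) = ?b i + k * ?l i" for k i
      by (simp only: distrib_right sum.distrib sum_distrib_left mult.assoc)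
    have B: "?B \<longleftrightarrow> (deriv \<phi> s \<noteq> 0 \<longrightarrow> (\<forall>i. ?P i = ?b i + e / r * (\<phi> s / deriv \<phi> s - s) * ?l i)) \<and>
        (deriv \<phi> s = 0 \<longrightarrow> (\<forall>i. ?l i = 0))"
      unfolding Let_def S S' s_def[symmetric] unfolding r_def[symmetric] e_def[symmetric] ..
    show ?thesis
    proof (cases "deriv \<phi> s = 0")
      case True
      \<comment> \<open>Only the last term survives, and its coefficient
        \<open>e / r * \<phi> s\<close> is nonzero.\<close>
      then show ?thesis unfolding A B using r e \<phi> by simp
    next
      case False
      have "deriv \<phi> s * ?P i = deriv \<phi> s * ?b i + e / r * (\<phi> s - s * deriv \<phi> s) * ?l i \<longleftrightarrow>
          ?P i = ?b i + e / r * (\<phi> s / deriv \<phi> s - s) * ?l i" for i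
      proof -
        have "deriv \<phi> s * ?b i + e / r * (\<phi> s - s * deriv \<phi> s) * ?l i =
            deriv \<phi> s * (?b i + e / r * (\<phi> s / deriv \<phi> s - s) * ?l i)"
          using False r by (simp add: field_simps)
        then show ?thesis using False by simp
      qed
      then show ?thesis unfolding A B using False by simp
    qed
  qed
  then show ?thesis unfolding berwald_condition_def by (auto split: prod.splits)
qed

text \<open>The formula for \<Gamma> is assumed on chart images only, because that is all that the
  description of the affine connection of \<open>F\<close> prescribes.\<close>

lemma represents_N_shift:
  assumes T: "symmetric_tensor12 \<C> T" "berwald_condition \<C> A a b \<phi> T"
    and eq: "\<And>c x j i k. c \<in> \<C> \<Longrightarrow> x \<in> chart_image c \<Longrightarrow>
      \<Gamma> c x $ j $ i $ k = levi_civita (a c) x $ j $ i $ k + T c x $ j $ i $ k"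
  shows "represents_N \<C> A F \<Gamma>"
  unfolding represents_N_iff_annihilates
proof (intro ballI conjI allI)
  fix c x j i k assume cx: "c \<in> \<C>" "x \<in> chart_image c"
  then show "\<Gamma> c x $ j $ i $ k = \<Gamma> c x $ j $ k $ i"
    using T(1) levi_civita_torsion_free
    by (simp add: eq symmetric_tensor12_def torsion_free_affine_connection_def)
next
  fix c z assume c: "c \<in> \<C>" and z: "z \<in> in_coords \<C> c A"
  then have "\<Gamma> c (fst z) = levi_civita (a c) (fst z) + T c (fst z)"
    using in_coords_base[of "fst z" "snd z"] by (simp add: vec_eq_iff eq)
  moreover have "annihilates (L c) (\<lambda>x. levi_civita (a c) x + T c x) z"
    using T(2) c z by (simp add: berwald_condition_iff)
  ultimately show "annihilates (L c) (\<Gamma> c) z" by (simp add: annihilates_def)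
qed

lemma difference_tensor:
  assumes N: "represents_N \<C> A F \<Gamma>"
  defines "T \<equiv> \<lambda>c x. \<Gamma> c x - levi_civita (a c) x"
  shows "symmetric_tensor12 \<C> T" "berwald_condition \<C> A a b \<phi> T"
proof -
  show "symmetric_tensor12 \<C> T"
    unfolding T_def
    by (rule connection_difference[OF represents_N_torsion_free[OF N] levi_civita_torsion_free])
  show "berwald_condition \<C> A a b \<phi> T"
    using N by (simp add: T_def berwald_condition_iff represents_N_iff_annihilates)
qed

end

theorem theorem5p2p3:
  fixes X :: "'m topology"
    and \<C> :: "('m, 'n::finite) chart set"
    and A :: "('m, 'n) tvec set"
    and a :: "('m, 'n) chart \<Rightarrow> real^'n \<Rightarrow> real^'n^'n"
    and b :: "('m, 'n) chart \<Rightarrow> real^'n \<Rightarrow> real^'n"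
    and D :: "real set"
    and \<phi> :: "real \<Rightarrow> real"
    and F :: "('m, 'n) tvec \<Rightarrow> real"
  assumes "smooth_manifold X \<C>"
    and "conic_subbundle \<C> A"
    and "pseudo_riemannian_metric \<C> a"
    and "one_form \<C> b"
    and "alpha_beta_metric \<C> A a b D \<phi> F"
  shows "(berwald_type \<C> A F \<longleftrightarrow>
            (\<exists>T. symmetric_tensor12 \<C> T \<and> berwald_condition \<C> A a b \<phi> T)) \<and>
         (\<forall>T. symmetric_tensor12 \<C> T \<and> berwald_condition \<C> A a b \<phi> T \<longrightarrow>
            (\<forall>\<Gamma>. affine_connection_of \<C> A F \<Gamma> \<longleftrightarrow>
              (\<forall>c\<in>\<C>. \<forall>x\<in>chart_image c. \<forall>j i k.
                 \<Gamma> c x $ j $ i $ k = levi_civita (a c) x $ j $ i $ k + T c x $ j $ i $ k)))"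
proof -
  have "finsler_metric \<C> A F" using assms(5) by (simp add: alpha_beta_metric_def)
  then interpret alpha_beta_manifold X \<C> A F a b D \<phi>
    using assms by unfold_locales
  have shift: "represents_N \<C> A F (\<lambda>c x. levi_civita (a c) x + T c x)"
    if "symmetric_tensor12 \<C> T" "berwald_condition \<C> A a b \<phi> T" for T
    by (rule represents_N_shift[OF that]) simp
  have "berwald_type \<C> A F \<longleftrightarrow> (\<exists>T. symmetric_tensor12 \<C> T \<and> berwald_condition \<C> A a b \<phi> T)"
    unfolding berwald_type_def using difference_tensor shift by blast
  moreover have "affine_connection_of \<C> A F \<Gamma> \<longleftrightarrow> (\<forall>c\<in>\<C>. \<forall>x\<in>chart_image c. \<forall>j i k.
      \<Gamma> c x $ j $ i $ k = levi_civita (a c) x $ j $ i $ k + T c x $ j $ i $ k)" (is "?l \<longleftrightarrow> ?r")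
    if T: "symmetric_tensor12 \<C> T" "berwald_condition \<C> A a b \<phi> T" for T \<Gamma>
  proof
    assume ?l
    then have "represents_N \<C> A F \<Gamma>" by (simp add: affine_connection_of_def)
    from represents_N_unique[OF this shift[OF T]] show ?r by simp
  next
    assume ?r
    then have "represents_N \<C> A F \<Gamma>" by (intro represents_N_shift[OF T]) blast
    then show ?l by (simp add: affine_connection_of_def represents_N_torsion_free)
  qed
  ultimately show ?thesis by blast
qed

end
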